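(* Let $N\ge1$, $k\ge2$, $w=k-2$, let $\lambda,\mu,\nu\in N^{-1}\mathbb{Z}^2$ with $\lambda+\mu+\nu\equiv(0,0)\pmod{\mathbb{Z}^2}$, and let $a,b,c\in\mathbb{C}$ with $a+b+c=0$. Then the function $$\Phi=\sum_{\substack{\ell+m=k\\ \ell,m\ge1}}\bigl(a^{\ell-1}E_{\ell,\lambda}+b^{\ell-1}E_{\ell,\mu}+c^{\ell-1}E_{\ell,\nu}\bigr)\bigl(a^{m-1}E_{m,\lambda}+b^{m-1}E_{m,\mu}+c^{m-1}E_{m,\nu}\bigr)$$ is holomorphic and belongs to $\mathcal{E}_k(N)$, i.e. it is a holomorphic Eisenstein series of weight $k$ and level $N$. Moreover, if $\lambda,\mu,\nu$ are all nonzero modulo $\mathbb{Z}^2$ and satisfy $\lambda+\mu+\nu=0$ exactly, then for $w\ge1$, $$\Phi=(w+1)\bigl(a^wE_{w+2,\lambda}+b^wE_{w+2,\mu}+c^wE_{w+2,\nu}\bigr),$$ and for $w=0$, $\Phi=E_{2,\lambda}+E_{2,\mu}+E_{2,\nu}-3E_{2,0}$.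
   Context: $\mathcal{H}$ is the upper half-plane, $z=x+iy$. For $\lambda\in\mathbb{Q}^2$, an integer $\ell\ge1$ and $s\in\mathbb{C}$, $E_{\ell,\lambda}(z,s)=\sum_{(a,b)\equiv\lambda\bmod\mathbb{Z}^2,\ (a,b)\neq(0,0)}(az+b)^{-\ell}|az+b|^{-s}y^{s/2}$ (absolutely convergent for $\operatorname{Re}s+\ell>2$, analytically continued in $s$), and $E_{\ell,\lambda}(z)=E_{\ell,\lambda}(z,0)$. These are holomorphic in $z$ except for $\ell=2$, where $E_{2,\lambda}(z)=-\pi y^{-1}+(\text{holomorphic})$. $\mathcal{E}_k(N)$ denotes the space of holomorphic functions lying in the $\mathbb{C}$-span of $\{E_{k,\lambda}:\lambda\in N^{-1}\mathbb{Z}^2\}$. Convention $0^0=1$. *)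

theory Defs
  imports "HOL-Complex_Analysis.Complex_Analysis"
begin

definition upper_half_plane :: "complex set"
  where "upper_half_plane = {z. Im z > 0}"

text \<open>The lattice \<open>N\<^sup>-\<^sup>1 \<int>\<^sup>2\<close>. Congruence modulo \<open>\<int>\<^sup>2\<close> is expressed by membership of the
  (componentwise) difference in \<^term>\<open>\<int> \<times> \<int> :: (rat \<times> rat) set\<close>.\<close>

definition level_lattice :: "nat \<Rightarrow> (rat \<times> rat) set"
  where "level_lattice N = {(of_int m / of_nat N, of_int n / of_nat N) | m n :: int. True}"

text \<open>Both complex powers have a positive real base for \<open>z\<close> in the upper half-plane, so
  \<^const>\<open>powr\<close> is the usual \<open>exp (s log _)\<close> with real logarithm. The sum is taken in the sense of
  unconditional (equivalently, absolute) convergence.\<close>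

definition eisenstein_series :: "nat \<Rightarrow> rat \<times> rat \<Rightarrow> complex \<Rightarrow> complex \<Rightarrow> complex"
  where "eisenstein_series l lam z s =
    (\<Sum>\<^sub>\<infinity>(p, q) \<in> {v. v - lam \<in> \<int> \<times> \<int> \<and> v \<noteq> (0, 0)}.
       (of_rat p * z + of_rat q) powi (- int l)
       * complex_of_real (cmod (of_rat p * z + of_rat q)) powr (- s)
       * complex_of_real (Im z) powr (s / 2))"

text \<open>\<open>v\<close> is a value at \<open>s\<close> of an analytic continuation, to some right half-plane containing
  \<open>s\<close>, of the series from its half-plane of absolute convergence \<open>Re t + l > 2\<close>. Right half-planes
  are nested, so by the identity theorem there is at most one such value (proved below);
  the value of an entire continuation is in particular such a value.\<close>

definition eisenstein_continuation_value ::
    "nat \<Rightarrow> rat \<times> rat \<Rightarrow> complex \<Rightarrow> complex \<Rightarrow> complex \<Rightarrow> bool"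
  where "eisenstein_continuation_value l lam z s v \<longleftrightarrow>
    (\<exists>\<sigma> f. \<sigma> < Re s \<and> \<sigma> < 2 - real l \<and> f holomorphic_on {t. Re t > \<sigma>} \<and>
       (\<forall>t. Re t + real l > 2 \<longrightarrow> f t = eisenstein_series l lam z t) \<and> f s = v)"

definition eisenstein_s :: "nat \<Rightarrow> rat \<times> rat \<Rightarrow> complex \<Rightarrow> complex \<Rightarrow> complex"
  where "eisenstein_s l lam z s = (THE v. eisenstein_continuation_value l lam z s v)"

definition eisenstein :: "nat \<Rightarrow> rat \<times> rat \<Rightarrow> complex \<Rightarrow> complex"
  where "eisenstein l lam z = eisenstein_s l lam z 0"

lemma eisenstein_continuation_value_unique:
  assumes "eisenstein_continuation_value l lam z s v"
    and "eisenstein_continuation_value l lam z s v'"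
  shows "v = v'"
proof -
  obtain \<sigma> f where f: "\<sigma> < Re s" "\<sigma> < 2 - real l" "f holomorphic_on {t. Re t > \<sigma>}"
    "\<And>t. Re t + real l > 2 \<Longrightarrow> f t = eisenstein_series l lam z t" "f s = v"
    using assms(1) unfolding eisenstein_continuation_value_def by blast
  obtain \<tau> g where g: "\<tau> < Re s" "\<tau> < 2 - real l" "g holomorphic_on {t. Re t > \<tau>}"
    "\<And>t. Re t + real l > 2 \<Longrightarrow> g t = eisenstein_series l lam z t" "g s = v'"
    using assms(2) unfolding eisenstein_continuation_value_def by blast
  define U where "U = {t. Re t > max \<sigma> \<tau>}"
  define V where "V = {t. Re t > 2 - real l}"
  have "f s = g s"
  proof (rule analytic_continuation_open[of V U f g])
    show "open V" "open U"
      unfolding U_def V_def by (rule open_halfspace_Re_gt)+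
    have "complex_of_real (3 - real l) \<in> V"
      by (simp add: V_def)
    then show "V \<noteq> {}"
      by blast
    show "connected U"
      unfolding U_def by (intro convex_connected convex_halfspace_Re_gt)
    show "V \<subseteq> U"
      using f(2) g(2) by (auto simp: U_def V_def)
    show "f holomorphic_on U" "g holomorphic_on U"
      using f(3) g(3) by (auto simp: U_def elim!: holomorphic_on_subset)
    show "f t = g t" if "t \<in> V" for t
      using that f(4)[of t] g(4)[of t] by (simp add: V_def)
    show "s \<in> U"
      using f(1) g(1) by (simp add: U_def)
  qed
  with f(5) g(5) show ?thesis
    by simp
qed

text \<open>The space of holomorphic Eisenstein series of weight \<open>k\<close> and level \<open>N\<close>. Functions on the
  upper half-plane are represented by total functions whose values elsewhere are irrelevant.\<close>

definition eisenstein_space :: "nat \<Rightarrow> nat \<Rightarrow> (complex \<Rightarrow> complex) set"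
  where "eisenstein_space k N =
    {f. f holomorphic_on upper_half_plane \<and>
        (\<exists>A coef. finite A \<and> A \<subseteq> level_lattice N \<and>
           (\<forall>z\<in>upper_half_plane. f z = (\<Sum>lam\<in>A. coef lam * eisenstein k lam z)))}"

definition eisenstein_triple ::
    "rat \<times> rat \<Rightarrow> rat \<times> rat \<Rightarrow> rat \<times> rat \<Rightarrow> complex \<Rightarrow> complex \<Rightarrow> complex \<Rightarrow>
     nat \<Rightarrow> complex \<Rightarrow> complex"
  where "eisenstein_triple lam mu nu a b c l z =
    a ^ (l - 1) * eisenstein l lam z + b ^ (l - 1) * eisenstein l mu z
    + c ^ (l - 1) * eisenstein l nu z"

definition Phi ::
    "nat \<Rightarrow> rat \<times> rat \<Rightarrow> rat \<times> rat \<Rightarrow> rat \<times> rat \<Rightarrow> complex \<Rightarrow> complex \<Rightarrow> complex \<Rightarrow>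
     complex \<Rightarrow> complex"
  where "Phi k lam mu nu a b c z =
    (\<Sum>(l, m) \<in> {(l, m). l + m = k \<and> 1 \<le> l \<and> 1 \<le> m}.
       eisenstein_triple lam mu nu a b c l z * eisenstein_triple lam mu nu a b c m z)"

end

theory Submission
  imports Defs
begin

text \<open>For \<open>u \<in> \<complex>\<close> let \<open>E\<^sub>l(u)\<close> be the continued value at \<open>s = 0\<close> of the sum of \<open>x\<^sup>-\<^sup>l \<bar>x\<bar>\<^sup>-\<^sup>s\<close>
  over the nonzero points \<open>x\<close> of \<open>u + \<Lambda>\<close>, \<open>\<Lambda> = \<int>z + \<int>\<close>. Up to one antiholomorphic linear term,
  \<open>E\<^sub>1(u - t)\<close> is the generating function \<open>\<Sum>\<^sub>n E\<^bsub>n+1\<^esub>(u) t\<^sup>n\<close>, minus \<open>1 / t\<close> if \<open>u \<in> \<Lambda>\<close>, and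
  \<open>E\<^sub>2\<close> is \<open>- dE\<^sub>1 / du\<close> away from \<open>\<Lambda>\<close>. Hence \<open>E\<^sub>1\<close> and \<open>E\<^sub>2\<close> play the roles of the Weierstrass functions
  \<open>\<zeta>\<close> and \<open>\<wp>\<close>, but are both periodic, and for \<open>u + v + w \<in> \<Lambda>\<close> the addition theorem
  \<open>(E\<^sub>1(u) + E\<^sub>1(v) + E\<^sub>1(w))\<^sup>2 = E\<^sub>2(u) + E\<^sub>2(v) + E\<^sub>2(w) - 3 E\<^sub>2(0)\<close> follows from Liouville's theorem.
  Replacing \<open>(u, v, w)\<close> by \<open>(u - a t, v - b t, w - c t)\<close>, the antiholomorphic terms cancel because
  \<open>a + b + c = 0\<close>, and comparing coefficients of powers of \<open>t\<close> expresses \<open>\<Phi>\<close> by the \<open>E\<^sub>k\<close>;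
  the poles at those of \<open>u, v, w\<close> that lie in \<open>\<Lambda>\<close> only contribute further multiples of \<open>E\<^sub>k\<close>.\<close>

section \<open>Lattice sums depending on a complex parameter\<close>

text \<open>The series for \<open>E_1\<close> and \<open>E_2\<close> are not absolutely summable at
  s = 0, so identities between values at 0 are proved far to the right and transferred by uniqueness
  of continuation. The continuation itself is elementary: differences along a period sum to zero,
  and the remainder of a first-order Taylor expansion decays two powers faster than the term. This
  moves the half-plane of convergence by two, just far enough to contain s = 0. The sum of the
  antiholomorphic derivatives carries a factor s but also has a pole at s = 0. Its limit
  \<open>- kappa\<close> makes \<open>E_1\<close> non-meromorphic in u, so Liouville's theorem is
  applied only to a combination in which the conjugates cancel. The substitution with t breaks down
  if, say, u lies in \<Lambda> and a = 0, because the first argument then stays on the lattice for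
  every t. In that case all triples vanish by parity and \<open>Phi\<close> is 0. In weight 2 every
  \<open>E_2\<close> has the same non-holomorphic part, so holomorphy of \<open>Phi\<close> requires
  the coefficients to add up to 0.\<close>

lemma holomorphic_infsum:
  fixes f :: "'a \<Rightarrow> complex \<Rightarrow> complex"
  assumes U: "open U"
    and hol: "\<And>x. x \<in> X \<Longrightarrow> f x holomorphic_on U"
    and dom: "\<And>s. s \<in> U \<Longrightarrow> \<exists>d>0. \<exists>M Y. finite Y \<and> M summable_on X \<and>
                 (\<forall>x\<in>X - Y. \<forall>t\<in>U. dist s t \<le> d \<longrightarrow> norm (f x t) \<le> M x)"
  shows "(\<lambda>s. \<Sum>\<^sub>\<infinity>x\<in>X. f x s) holomorphic_on U"
    and "\<And>s. s \<in> U \<Longrightarrow> (\<lambda>x. f x s) summable_on X"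
proof -
  have *: "(\<lambda>s. \<Sum>\<^sub>\<infinity>x\<in>X. f x s) field_differentiable at s \<and> (\<lambda>x. f x s) summable_on X" if s: "s \<in> U" for s
  proof -
    from dom[OF s] obtain d M Y where d: "d > 0" "finite Y" "M summable_on X"
      "\<And>x t. x \<in> X - Y \<Longrightarrow> t \<in> U \<Longrightarrow> dist s t \<le> d \<Longrightarrow> norm (f x t) \<le> M x" by blast
    obtain e where e: "e > 0" "cball s e \<subseteq> U"
      using U s open_contains_cball by blast
    define r where "r = min d e"
    have r: "r > 0" "cball s r \<subseteq> U" "r \<le> d" using d e by (auto simp: r_def)
    \<comment> \<open>For the finitely many x in \<open>Y\<close> the bound comes from compactness
      of the disc. In the applications these are points near the origin, where estimates valid for
      large terms fail.\<close>
    have "\<forall>x\<in>X. \<exists>B. \<forall>t\<in>cball s r. norm (f x t) \<le> B"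
    proof
      fix x assume x: "x \<in> X"
      have "continuous_on (cball s r) (f x)"
        using hol[OF x] r(2) by (meson continuous_on_subset holomorphic_on_imp_continuous_on)
      then have "bounded (f x ` cball s r)"
        by (intro compact_imp_bounded compact_continuous_image) auto
      then show "\<exists>B. \<forall>t\<in>cball s r. norm (f x t) \<le> B"
        by (auto simp: bounded_iff)
    qed
    then obtain B where B: "\<And>x t. x \<in> X \<Longrightarrow> t \<in> cball s r \<Longrightarrow> norm (f x t) \<le> B x" by metis
    define M' where "M' x = (if x \<in> Y then B x else M x)" for x
    have bd: "norm (f x t) \<le> M' x" if "x \<in> X" "t \<in> cball s r" for x t
      using B[OF that] d(4)[of x t] that r by (auto simp: M'_def dist_commute)
    have M': "M' summable_on X"
    proof -
      have "M summable_on (X - Y)"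
        using d(3) by (rule summable_on_subset) auto
      then have "M' summable_on (X - Y)"
        by (rule summable_on_cong[THEN iffD2, rotated]) (auto simp: M'_def)
      moreover have "M' summable_on (X \<inter> Y)" using d(2) by simp
      ultimately have "M' summable_on ((X - Y) \<union> (X \<inter> Y))" by (rule summable_on_union)
      moreover have "(X - Y) \<union> (X \<inter> Y) = X" by blast
      ultimately show ?thesis by simp
    qed
    have ul: "uniform_limit (cball s r) (\<lambda>A t. \<Sum>x\<in>A. f x t) (\<lambda>t. \<Sum>\<^sub>\<infinity>x\<in>X. f x t) (finite_subsets_at_top X)"
      by (rule Weierstrass_m_test_general[OF bd M'])
    have ev: "\<forall>\<^sub>F A in finite_subsets_at_top X. continuous_on (cball s r) (\<lambda>t. \<Sum>x\<in>A. f x t) \<and>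
              (\<lambda>t. \<Sum>x\<in>A. f x t) holomorphic_on ball s r"
    proof (rule eventually_finite_subsets_at_top_weakI)
      fix A assume A: "finite A" "A \<subseteq> X"
      have "(\<lambda>t. \<Sum>x\<in>A. f x t) holomorphic_on cball s r"
        using A r by (intro holomorphic_on_sum) (meson hol holomorphic_on_subset subsetD)
      then show "continuous_on (cball s r) (\<lambda>t. \<Sum>x\<in>A. f x t) \<and> (\<lambda>t. \<Sum>x\<in>A. f x t) holomorphic_on ball s r"
        using holomorphic_on_imp_continuous_on holomorphic_on_subset ball_subset_cball by blast
    qed
    have "(\<lambda>s. \<Sum>\<^sub>\<infinity>x\<in>X. f x s) holomorphic_on ball s r"
      by (rule holomorphic_uniform_limit[OF ev ul]) auto
    then have "(\<lambda>s. \<Sum>\<^sub>\<infinity>x\<in>X. f x s) field_differentiable at s"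
      using r(1) by (intro holomorphic_on_imp_differentiable_at[of _ "ball s r"]) auto
    moreover have "(\<lambda>x. f x s) summable_on X"
      by (rule abs_summable_summable, rule Infinite_Sum.abs_summable_on_comparison_test'[OF M'], rule bd) (use r in auto)
    ultimately show ?thesis by blast
  qed
  show "(\<lambda>s. \<Sum>\<^sub>\<infinity>x\<in>X. f x s) holomorphic_on U"
    unfolding holomorphic_on_def using * field_differentiable_at_within by blast
  show "\<And>s. s \<in> U \<Longrightarrow> (\<lambda>x. f x s) summable_on X" using * by blast
qed

lemma summable_on_int_powr:
  assumes "a > 1"
  shows "(\<lambda>m::int. (1 + \<bar>real_of_int m\<bar>) powr (-a)) summable_on UNIV"
proof -
  have "summable (\<lambda>n. real (Suc n) powr (-a))"
    using assms by (subst summable_Suc_iff) (simp add: summable_real_powr_iff)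
  then have "(\<lambda>n. real (Suc n) powr (-a)) summable_on UNIV"
    by (intro summable_nonneg_imp_summable_on) auto
  then have s: "(\<lambda>n. (1 + real n) powr (-a)) summable_on UNIV"
    by (simp add: add_ac)
  have "(\<lambda>m::int. (1 + \<bar>real_of_int m\<bar>) powr (-a)) summable_on range int"
    by (subst summable_on_reindex) (use s in \<open>auto simp: o_def\<close>)
  moreover have "(\<lambda>m::int. (1 + \<bar>real_of_int m\<bar>) powr (-a)) summable_on range (\<lambda>n. - int n)"
    by (subst summable_on_reindex) (use s in \<open>auto simp: o_def inj_def\<close>)
  ultimately have "(\<lambda>m::int. (1 + \<bar>real_of_int m\<bar>) powr (-a)) summable_on (range int \<union> range (\<lambda>n. - int n))"
    by (rule summable_on_union)
  moreover have "range int \<union> range (\<lambda>n. - int n) = UNIV"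
    by (auto simp: image_iff) (metis int_cases2)
  ultimately show ?thesis by simp
qed

text \<open>Since (1 + |m|) (1 + |n|) <= (1 + |m| + |n|)^2, this function dominates (1 + |m| +
  |n|)^(-r), and it factors into two sums over the integers with exponent r/2 > 1.\<close>

lemma summable_on_int_pair_powr:
  assumes "r > 2"
  shows "(\<lambda>v::int \<times> int. ((1 + \<bar>real_of_int (fst v)\<bar>) * (1 + \<bar>real_of_int (snd v)\<bar>)) powr (-r/2)) summable_on UNIV"
proof -
  define h where "h m = (1 + \<bar>real_of_int m\<bar>) powr (-r/2)" for m :: int
  have h: "h summable_on UNIV"
    using summable_on_int_powr[of "r/2"] assms by (simp add: h_def [abs_def])
  have "(\<lambda>(m,n). h m * h n) summable_on (UNIV \<times> UNIV)"
  proof (rule summable_on_SigmaI)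
    fix m :: int
    show "((\<lambda>y. (case (m, y) of (m, n) \<Rightarrow> h m * h n)) has_sum (h m * infsum h UNIV)) UNIV"
      using has_sum_cmult_right[of h UNIV "infsum h UNIV" "h m"] h by simp
  next
    show "(\<lambda>m. h m * infsum h UNIV) summable_on UNIV"
      using h by (rule summable_on_cmult_left)
  qed (auto simp: h_def)
  then show ?thesis
    by (simp add: h_def powr_mult case_prod_unfold)
qed

text \<open>The imaginary part controls p, then the triangle inequality controls q. The constant is
  explicit in z so that \<open>upper_half_plane_comparison\<close> can make it uniform near a
  point.\<close>

lemma norm_real_combination_ge:
  assumes "Im z > 0"
  shows "\<bar>p\<bar> + \<bar>q\<bar> \<le> (1 + (1 + cmod z) / Im z) * cmod (of_real p * z + of_real q)"
proof -
  let ?x = "of_real p * z + of_real q"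
  have "\<bar>p\<bar> * Im z = \<bar>Im ?x\<bar>" using assms by (simp add: abs_mult)
  also have "\<dots> \<le> cmod ?x" by (rule abs_Im_le_cmod)
  finally have p: "\<bar>p\<bar> \<le> cmod ?x / Im z" using assms by (simp add: field_simps)
  have "\<bar>q\<bar> = cmod (?x - of_real p * z)" by simp
  also have "\<dots> \<le> cmod ?x + cmod (of_real p * z)" by (rule norm_triangle_ineq4)
  also have "\<dots> = cmod ?x + \<bar>p\<bar> * cmod z" by (simp add: norm_mult)
  also have "\<dots> \<le> cmod ?x + cmod ?x / Im z * cmod z"
    using p by (intro add_left_mono mult_right_mono) auto
  finally have "\<bar>q\<bar> \<le> cmod ?x + cmod ?x / Im z * cmod z" .
  with p have "\<bar>p\<bar> + \<bar>q\<bar> \<le> cmod ?x / Im z + (cmod ?x + cmod ?x / Im z * cmod z)" by linarith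
  also have "\<dots> = (1 + (1 + cmod z) / Im z) * cmod ?x" using assms by (simp add: field_simps)
  finally show ?thesis .
qed

locale upper_half_point =
  fixes z :: complex
  assumes Im_pos: "Im z > 0"
begin

definition lat :: "int \<times> int \<Rightarrow> complex"
  where "lat v = of_int (fst v) * z + of_int (snd v)"

definition Lam :: "complex set" where "Lam = range lat"

lemma lat_add: "lat (v + w) = lat v + lat w"
  by (simp add: lat_def algebra_simps)

lemma lat_minus: "lat (- v) = - lat v"
  by (simp add: lat_def algebra_simps)

lemma lat_zero [simp]: "lat 0 = 0"
  by (simp add: lat_def)

lemma lat_diff: "lat (v - w) = lat v - lat w"
  by (simp add: lat_def algebra_simps)

lemma lat_bound:
  obtains K where "K \<ge> 1" "\<And>v. \<bar>real_of_int (fst v)\<bar> + \<bar>real_of_int (snd v)\<bar> \<le> K * cmod (lat v)"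
proof
  show "1 + (1 + cmod z) / Im z \<ge> 1" using Im_pos by simp
  show "\<bar>real_of_int (fst v)\<bar> + \<bar>real_of_int (snd v)\<bar> \<le> (1 + (1 + cmod z) / Im z) * cmod (lat v)" for v
    using norm_real_combination_ge[OF Im_pos, of "of_int (fst v)" "of_int (snd v)"]
    by (simp add: lat_def)
qed

lemma lat_eq_0_iff [simp]: "lat v = 0 \<longleftrightarrow> v = 0"
  using Im_pos by (auto simp: lat_def complex_eq_iff prod_eq_iff)

lemma Lam_closed:
  "0 \<in> Lam" "u \<in> Lam \<Longrightarrow> v \<in> Lam \<Longrightarrow> u + v \<in> Lam" "u \<in> Lam \<Longrightarrow> v \<in> Lam \<Longrightarrow> u - v \<in> Lam"
  "u \<in> Lam \<Longrightarrow> - u \<in> Lam"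
  unfolding Lam_def
  using rangeI[of lat 0] by (auto simp del: rangeI simp flip: lat_add lat_diff lat_minus intro: rangeI)

lemma finite_lat_ball: "finite {v. cmod (u + lat v) \<le> R}"
proof -
  obtain K where K: "K \<ge> 1" "\<And>v. \<bar>real_of_int (fst v)\<bar> + \<bar>real_of_int (snd v)\<bar> \<le> K * cmod (lat v)"
    using lat_bound by blast
  define C where "C = \<lceil>K * (R + cmod u)\<rceil>"
  have "{v. cmod (u + lat v) \<le> R} \<subseteq> {-C..C} \<times> {-C..C}"
  proof
    fix v assume "v \<in> {v. cmod (u + lat v) \<le> R}"
    then have "cmod (u + lat v) \<le> R" by simp
    moreover have "cmod (lat v) \<le> cmod (u + lat v) + cmod u"
      using norm_triangle_ineq4[of "u + lat v" u] by simp
    ultimately have "K * cmod (lat v) \<le> K * (R + cmod u)"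
      using K(1) by (intro mult_left_mono) auto
    then have "\<bar>real_of_int (fst v)\<bar> + \<bar>real_of_int (snd v)\<bar> \<le> of_int C"
      using K(2)[of v] unfolding C_def by linarith
    then have "\<bar>fst v\<bar> \<le> C" "\<bar>snd v\<bar> \<le> C" by linarith+
    then show "v \<in> {-C..C} \<times> {-C..C}" by (auto simp: mem_Times_iff)
  qed
  then show ?thesis by (rule finite_subset) auto
qed

lemma summable_lat_powr:
  assumes r: "r > 2"
  shows "(\<lambda>v. cmod (u + lat v) powr (-r)) summable_on UNIV"
proof -
  obtain K where K: "K \<ge> 1" "\<And>v. \<bar>real_of_int (fst v)\<bar> + \<bar>real_of_int (snd v)\<bar> \<le> K * cmod (lat v)"
    using lat_bound by blast
  define h where "h v = ((1 + \<bar>real_of_int (fst v)\<bar>) * (1 + \<bar>real_of_int (snd v)\<bar>)) powr (-r/2)" for v :: "int \<times> int"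
  \<comment> \<open>For x = u + lat v with |x| > 1 the chain is 1 + |m| + |n| <= K (1 + |lat v|) <=
    K (1 + |u|) (1 + |x|) <= L |x|; the factor 2 comes from 1 + |x| <= 2 |x|. The points with |x| <=
    1 are finitely many.\<close>
  define L where "L = 2 * K * (1 + cmod u)"
  have L: "L > 0" using K by (simp add: L_def add_pos_nonneg)
  have bd: "cmod (u + lat v) powr (-r) \<le> L powr r * h v" if v: "cmod (u + lat v) > 1" for v
  proof -
    let ?m = "\<bar>real_of_int (fst v)\<bar>" and ?n = "\<bar>real_of_int (snd v)\<bar>" and ?x = "cmod (u + lat v)"
    have "(1 + ?m) * (1 + ?n) \<le> (1 + ?m + ?n)^2"
      by (simp add: power2_eq_square algebra_simps)
    then have 1: "sqrt ((1 + ?m) * (1 + ?n)) \<le> 1 + ?m + ?n" by (intro real_le_lsqrt) auto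
    have 2: "1 + ?m + ?n \<le> K * (1 + cmod (lat v))"
      using K(1) K(2)[of v] by (simp add: algebra_simps)
    have 3: "1 + cmod (lat v) \<le> (1 + cmod u) * (1 + ?x)"
    proof -
      have "cmod (lat v) \<le> ?x + cmod u"
        using norm_triangle_ineq4[of "u + lat v" u] by simp
      moreover have "0 \<le> cmod u * ?x" by simp
      ultimately have "1 + cmod (lat v) \<le> 1 + ?x + cmod u + cmod u * ?x" by linarith
      then show ?thesis by (simp add: algebra_simps)
    qed
    have 4: "K * (1 + cmod (lat v)) \<le> K * ((1 + cmod u) * (1 + ?x))"
      using 3 K(1) by (intro mult_left_mono) auto
    have 5: "K * ((1 + cmod u) * (1 + ?x)) \<le> K * ((1 + cmod u) * (2 * ?x))"
      using v K(1) by (intro mult_left_mono) auto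
    have 6: "sqrt ((1 + ?m) * (1 + ?n)) \<le> L * ?x"
      using 1 2 4 5 by (simp add: L_def algebra_simps)
    have "(L * ?x) powr (-r) \<le> sqrt ((1 + ?m) * (1 + ?n)) powr (-r)"
      using r 6 by (intro powr_mono2') (auto intro!: mult_pos_pos add_pos_nonneg)
    also have "\<dots> = h v"
      by (simp add: h_def powr_half_sqrt[symmetric] powr_powr)
    finally have "(L * ?x) powr (-r) \<le> h v" .
    moreover have "(L * ?x) powr (-r) = L powr (-r) * ?x powr (-r)"
      using L by (simp add: powr_mult)
    ultimately have "L powr r * (L powr (-r) * ?x powr (-r)) \<le> L powr r * h v"
      by (intro mult_left_mono) auto
    then show ?thesis
      using L by (simp add: mult.assoc[symmetric] powr_add[symmetric])
  qed
  have s: "(\<lambda>v. L powr r * h v) summable_on UNIV"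
    using summable_on_int_pair_powr[OF r] unfolding h_def by (intro summable_on_cmult_right)
  have "(\<lambda>v. cmod (u + lat v) powr (-r)) summable_on {v. cmod (u + lat v) > 1}"
    by (rule summable_on_comparison_test[OF summable_on_subset[OF s]]) (use bd in auto)
  moreover have "(\<lambda>v. cmod (u + lat v) powr (-r)) summable_on {v. cmod (u + lat v) \<le> 1}"
    using finite_lat_ball by simp
  ultimately have "(\<lambda>v. cmod (u + lat v) powr (-r)) summable_on
      ({v. cmod (u + lat v) > 1} \<union> {v. cmod (u + lat v) \<le> 1})"
    by (rule summable_on_union)
  moreover have "{v. cmod (u + lat v) > 1} \<union> {v. cmod (u + lat v) \<le> 1} = UNIV" by auto
  ultimately show ?thesis by simp
qed

end

lemma has_sum_diff:
  fixes f g :: "'a \<Rightarrow> 'b::real_normed_vector"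
  assumes "(f has_sum a) A" "(g has_sum b) A"
  shows "((\<lambda>x. f x - g x) has_sum (a - b)) A"
proof -
  have "((\<lambda>x. - g x) has_sum (- b)) A" using assms(2) by (simp add: has_sum_uminus)
  from has_sum_add[OF assms(1) this] show ?thesis by simp
qed

section \<open>Hecke's terms and their Taylor remainders\<close>

text \<open>Since \<open>0 powr _ = 0\<close>, the value at \<open>x = 0\<close> is \<open>0\<close>, so sums over all lattice points leave out the
  origin.\<close>

definition hecke_term :: "int \<Rightarrow> complex \<Rightarrow> complex \<Rightarrow> complex"
  where "hecke_term n s x = x powi n * complex_of_real (cmod x) powr (- s)"

definition hecke_diff1 :: "int \<Rightarrow> complex \<Rightarrow> complex \<Rightarrow> complex \<Rightarrow> complex"
  where "hecke_diff1 n \<omega> s x = hecke_term n s (x + \<omega>) - hecke_term n s x"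

text \<open>Wirtinger derivatives of \<^term>\<open>\<lambda>x. hecke_term n s x\<close>.\<close>

definition hecke_d :: "int \<Rightarrow> complex \<Rightarrow> complex \<Rightarrow> complex"
  where "hecke_d n s x = (of_int n - s / 2) * hecke_term (n - 1) s x"

definition hecke_dbar :: "int \<Rightarrow> complex \<Rightarrow> complex \<Rightarrow> complex"
  where "hecke_dbar n s x = - (s / 2) * hecke_term (n + 1) (s + 2) x"

text \<open>The Taylor remainder of order one for a function that is only real differentiable, hence
  with both \<omega> and its conjugate in the linear part.\<close>

definition hecke_diff2 :: "int \<Rightarrow> complex \<Rightarrow> complex \<Rightarrow> complex \<Rightarrow> complex"
  where "hecke_diff2 n \<omega> s x = hecke_diff1 n \<omega> s x - (\<omega> * hecke_d n s x + cnj \<omega> * hecke_dbar n s x)"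

lemma hecke_term_0 [simp]: "hecke_term n s 0 = 0"
  by (simp add: hecke_term_def)

lemma norm_hecke_term:
  "x \<noteq> 0 \<Longrightarrow> cmod (hecke_term n s x) = cmod x powr (of_int n - Re s)"
  by (simp add: hecke_term_def norm_mult norm_power_int norm_powr_real_powr norm_inverse
      powr_diff powr_minus divide_inverse flip: powr_real_of_int')

lemma holomorphic_hecke_term [holomorphic_intros]:
  "f holomorphic_on A \<Longrightarrow> (\<lambda>s. hecke_term n (f s) x) holomorphic_on A"
proof (cases "x = 0")
  case False
  assume "f holomorphic_on A"
  then have "(\<lambda>s. x powi n * exp (- f s * ln (complex_of_real (cmod x)))) holomorphic_on A"
    by (intro holomorphic_intros)
  then show ?thesis using False by (simp add: hecke_term_def powr_def)
qed simp

lemma holomorphic_hecke_diff1: "(\<lambda>s. hecke_diff1 n \<omega> s x) holomorphic_on A"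
  unfolding hecke_diff1_def by (intro holomorphic_intros)

lemma holomorphic_hecke_diff2: "(\<lambda>s. hecke_diff2 n \<omega> s x) holomorphic_on A"
  unfolding hecke_diff2_def hecke_diff1_def hecke_d_def hecke_dbar_def
  by (intro holomorphic_intros) auto

lemma hecke_term_deriv:
  assumes "x + of_real t * \<omega> \<noteq> 0"
  shows "((\<lambda>t. hecke_term n s (x + of_real t * \<omega>)) has_vector_derivative
     (\<omega> * hecke_d n s (x + of_real t * \<omega>) + cnj \<omega> * hecke_dbar n s (x + of_real t * \<omega>))) (at t within S)"
proof -
  define y where "y t = x + of_real t * \<omega>" for t :: real
  have y0: "y t \<noteq> 0" using assms by (simp add: y_def)
  have dy: "(y has_vector_derivative \<omega>) (at t within S)"
    unfolding y_def by (auto intro!: derivative_eq_intros)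
  have dc: "((\<lambda>t. cnj (y t)) has_vector_derivative cnj \<omega>) (at t within S)"
    using dy by (rule has_vector_derivative_cnj)
  \<comment> \<open>Writing |y|^(-s) as (y * cnj y)^(-s/2) replaces the norm by a differentiable
    product, which is positive at \<open>t\<close> and so off the branch cut of
    \<open>powr\<close>.\<close>
  define e where "e t = y t * cnj (y t)" for t
  have de: "(e has_vector_derivative (y t * cnj \<omega> + \<omega> * cnj (y t))) (at t within S)"
    unfolding e_def by (rule has_vector_derivative_mult[OF dy dc])
  have e_eq: "e t = of_real ((cmod (y t))\<^sup>2)" for t
    unfolding e_def by (rule complex_norm_square[symmetric])
  have e_pos: "e t \<notin> \<real>\<^sub>\<le>\<^sub>0" using y0 by (simp only: e_eq nonpos_Reals_of_real_iff) simp
  have 1: "((\<lambda>t. e t powr (-(s/2))) has_vector_derivative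
       ((y t * cnj \<omega> + \<omega> * cnj (y t)) * ((-(s/2)) * e t powr (-(s/2) - 1)))) (at t within S)"
  proof -
    have "((\<lambda>w. w powr (-(s/2))) has_field_derivative ((-(s/2)) * e t powr (-(s/2) - 1))) (at (e t))"
      by (rule has_field_derivative_powr[OF e_pos])
    from field_vector_diff_chain_within[OF de has_field_derivative_at_within[OF this]]
    show ?thesis by (simp add: o_def)
  qed
  have 2: "((\<lambda>t. y t powi n) has_vector_derivative (\<omega> * (of_int n * y t powi (n - 1)))) (at t within S)"
  proof -
    have "((\<lambda>w. w powi n) has_field_derivative (of_int n * y t powi (n - 1) * 1)) (at (y t))"
      by (rule DERIV_power_int) (use y0 in auto)
    from field_vector_diff_chain_within[OF dy has_field_derivative_at_within[OF this]]
    show ?thesis by (simp add: o_def)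
  qed
  have ht: "hecke_term m s' (y t) = y t powi m * e t powr (-(s'/2))" for m s' t
  proof (cases "y t = 0")
    case False
    have "e t = (complex_of_real (cmod (y t))) powr 2"
      using False by (simp add: e_eq powr_to_1 powr_numeral power2_eq_square flip: of_real_power)
    moreover have "((complex_of_real (cmod (y t))) powr 2) powr (-(s'/2)) = complex_of_real (cmod (y t)) powr (-s')"
      using False by (simp add: powr_def Ln_of_real flip: of_real_mult) 
    ultimately show ?thesis by (simp add: hecke_term_def)
  qed (simp add: e_def)
  have 3: "((\<lambda>t. y t powi n * e t powr (-(s/2))) has_vector_derivative
      (y t powi n * ((y t * cnj \<omega> + \<omega> * cnj (y t)) * ((-(s/2)) * e t powr (-(s/2) - 1)))
       + (\<omega> * (of_int n * y t powi (n - 1))) * e t powr (-(s/2)))) (at t within S)"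
    by (rule has_vector_derivative_mult[OF 2 1])
  have a: "e t powr (-(s/2)) = e t powr (-(s/2) - 1) * (y t * cnj (y t))"
  proof -
    have "e t powr (-(s/2) - 1) * e t = e t powr (-(s/2))"
      using y0 by (simp add: powr_diff e_def)
    then show ?thesis by (simp add: e_def)
  qed
  have b: "y t powi (n + 1) = y t powi n * y t" "y t powi n = y t powi (n - 1) * y t"
    using y0 by (simp_all add: power_int_add power_int_diff)
  have "(y t powi n * ((y t * cnj \<omega> + \<omega> * cnj (y t)) * ((-(s/2)) * e t powr (-(s/2) - 1)))
       + (\<omega> * (of_int n * y t powi (n - 1))) * e t powr (-(s/2)))
      = \<omega> * hecke_d n s (y t) + cnj \<omega> * hecke_dbar n s (y t)"
  proof -
    have c: "- ((s + 2) / 2) = -(s/2) - 1" by (simp add: add_divide_distrib)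
    show ?thesis
      unfolding hecke_d_def hecke_dbar_def ht c a b by (simp add: algebra_simps)
  qed
  with 3 have "((\<lambda>t. y t powi n * e t powr -(s/2)) has_vector_derivative
      \<omega> * hecke_d n s (y t) + cnj \<omega> * hecke_dbar n s (y t)) (at t within S)" by (rule back_subst)
  then show ?thesis unfolding ht[symmetric] unfolding y_def .
qed

section \<open>Decay of the first difference and of the Taylor remainder\<close>

lemma powr_two_bounds:
  fixes x y d D :: real
  assumes "0 < x" "x / 2 \<le> y" "y \<le> 2 * x" "\<bar>d\<bar> \<le> D"
  shows "y powr d \<le> 2 powr D * x powr d"
proof (cases "d \<ge> 0")
  case True
  have "y powr d \<le> (2 * x) powr d" using assms True by (intro powr_mono2) auto
  also have "\<dots> = 2 powr d * x powr d" using assms by (simp add: powr_mult)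
  also have "\<dots> \<le> 2 powr D * x powr d" using assms by (intro mult_right_mono powr_mono) auto
  finally show ?thesis .
next
  case False
  have "y powr d \<le> (x / 2) powr d" using assms False by (intro powr_mono2') auto
  also have "\<dots> = 2 powr (-d) * x powr d" using assms by (simp add: powr_divide powr_minus field_simps)
  also have "\<dots> \<le> 2 powr D * x powr d" using assms by (intro mult_right_mono powr_mono) auto
  finally show ?thesis .
qed

lemma norm_between:
  fixes x \<omega> :: complex
  assumes "2 * cmod \<omega> \<le> cmod x" "0 \<le> t" "t \<le> 1"
  shows "cmod x / 2 \<le> cmod (x + of_real t * \<omega>)" "cmod (x + of_real t * \<omega>) \<le> 2 * cmod x"
    "cmod (of_real t * \<omega>) \<le> cmod \<omega>"
proof -
  show 1: "cmod (of_real t * \<omega>) \<le> cmod \<omega>"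
    using assms by (simp add: norm_mult mult_left_le_one_le)
  show "cmod x / 2 \<le> cmod (x + of_real t * \<omega>)"
    using norm_diff_ineq[of x "of_real t * \<omega>"] 1 assms(1) by linarith
  show "cmod (x + of_real t * \<omega>) \<le> 2 * cmod x"
    using norm_triangle_ineq[of x "of_real t * \<omega>"] 1 assms(1) norm_ge_zero[of \<omega>] by linarith
qed

lemma hecke_term_near_bound:
  assumes "x \<noteq> 0" "cmod x / 2 \<le> cmod y" "cmod y \<le> 2 * cmod x" "cmod s \<le> B"
  shows "cmod (hecke_term n s y) \<le> 2 powr (\<bar>of_int n\<bar> + B) * cmod x powr (of_int n - Re s)"
proof -
  have "y \<noteq> 0" using assms by auto
  have "\<bar>of_int n - Re s\<bar> \<le> \<bar>of_int n\<bar> + B" using abs_Re_le_cmod[of s] assms(4) by linarith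
  then show ?thesis
    using assms powr_two_bounds[of "cmod x" "cmod y"] \<open>y \<noteq> 0\<close> by (simp add: norm_hecke_term)
qed

text \<open>Mean value inequality on the segment from x to x + \<omega>, which avoids 0 and stays
  comparable with |x|. Uniformity in s makes the lattice sums holomorphic; uniformity in \<omega>
  lets \<open>hecke_diff2_bound\<close> use all increments t \<omega> at once.\<close>

lemma hecke_diff1_bound:
  obtains C where "C \<ge> 0" "\<And>s x \<omega>. cmod s \<le> B \<Longrightarrow> 2 * cmod \<omega> \<le> cmod x \<Longrightarrow> x \<noteq> 0 \<Longrightarrow>
     cmod (hecke_diff1 n \<omega> s x) \<le> C * cmod \<omega> * cmod x powr (of_int n - Re s - 1)"
proof
  define K1 where "K1 = (2::real) powr (\<bar>of_int (n - 1)\<bar> + B)"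
  \<comment> \<open>The antiholomorphic derivative is a term with parameter s + 2, whose norm is at
    most B + 2.\<close>
  define K2 where "K2 = (2::real) powr (\<bar>of_int (n + 1)\<bar> + (B + 2))"
  define C where "C = (\<bar>of_int n\<bar> + \<bar>B\<bar>) * K1 + \<bar>B\<bar> * K2"
  show "C \<ge> 0" by (simp add: C_def K1_def K2_def)
  fix s x \<omega> :: complex
  assume s: "cmod s \<le> B" and w: "2 * cmod \<omega> \<le> cmod x" and x: "x \<noteq> 0"
  let ?d = "of_int n - Re s - 1"
  let ?y = "\<lambda>t. x + complex_of_real t * \<omega>"
  have *: "cmod (\<omega> * hecke_d n s (?y t) + cnj \<omega> * hecke_dbar n s (?y t)) \<le> C * cmod \<omega> * cmod x powr ?d"
    if t: "t \<in> {0..1}" for t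
  proof -
    note nb = norm_between[OF w, of t]
    have 1: "cmod (hecke_term (n - 1) s (?y t)) \<le> K1 * cmod x powr ?d"
      using hecke_term_near_bound[OF x _ _ s, of "?y t" "n - 1"] nb t by (simp add: K1_def algebra_simps)
    have "cmod (s + 2) \<le> B + 2" using norm_triangle_ineq[of s 2] s by simp
    from hecke_term_near_bound[OF x _ _ this, of "?y t" "n + 1"]
    have 2: "cmod (hecke_term (n + 1) (s + 2) (?y t)) \<le> K2 * cmod x powr ?d"
      using nb t by (simp add: K2_def algebra_simps)
    have "cmod (of_int n - s / 2) \<le> \<bar>of_int n\<bar> + cmod s / 2"
      using norm_triangle_ineq4[of "of_int n" "s/2"] by (simp add: norm_divide)
    then have 3: "cmod (of_int n - s / 2) \<le> \<bar>of_int n\<bar> + \<bar>B\<bar>" using s norm_ge_zero[of s] by linarith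
    have 4: "cmod (- (s / 2)) \<le> \<bar>B\<bar>" using s norm_ge_zero[of s] by (simp add: norm_divide)
    have "cmod (hecke_d n s (?y t)) \<le> (\<bar>of_int n\<bar> + \<bar>B\<bar>) * (K1 * cmod x powr ?d)"
      unfolding hecke_d_def norm_mult using 1 3 by (intro mult_mono) auto
    moreover have "cmod (hecke_dbar n s (?y t)) \<le> \<bar>B\<bar> * (K2 * cmod x powr ?d)"
      unfolding hecke_dbar_def norm_mult using 2 4 by (intro mult_mono) auto
    ultimately have "cmod (\<omega> * hecke_d n s (?y t) + cnj \<omega> * hecke_dbar n s (?y t))
       \<le> cmod \<omega> * ((\<bar>of_int n\<bar> + \<bar>B\<bar>) * (K1 * cmod x powr ?d)) + cmod \<omega> * (\<bar>B\<bar> * (K2 * cmod x powr ?d))"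
      by (intro norm_triangle_le add_mono) (auto simp: norm_mult intro!: mult_left_mono)
    then show ?thesis by (simp add: C_def algebra_simps)
  qed
  have "norm (hecke_term n s (?y 1) - hecke_term n s (?y 0)) \<le> (C * cmod \<omega> * cmod x powr ?d) * norm (1 - 0 :: real)"
  proof (rule differentiable_bound[of "{0..1}" "\<lambda>t. hecke_term n s (?y t)"])
    fix t :: real assume t: "t \<in> {0..1}"
    have "?y t \<noteq> 0" using norm_between[OF w, of t] t x by auto
    from hecke_term_deriv[OF this, of n s "{0..1}"]
    show "((\<lambda>t. hecke_term n s (?y t)) has_derivative
        (\<lambda>h. h *\<^sub>R (\<omega> * hecke_d n s (?y t) + cnj \<omega> * hecke_dbar n s (?y t)))) (at t within {0..1})"
      by (simp add: has_vector_derivative_def)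
    show "onorm (\<lambda>h. h *\<^sub>R (\<omega> * hecke_d n s (?y t) + cnj \<omega> * hecke_dbar n s (?y t)))
          \<le> C * cmod \<omega> * cmod x powr ?d"
      by (rule onorm_le) (use mult_left_mono[OF *[OF t] abs_ge_zero] in \<open>simp add: mult_ac\<close>)
  qed auto
  then show "cmod (hecke_diff1 n \<omega> s x) \<le> C * cmod \<omega> * cmod x powr ?d"
    by (simp add: hecke_diff1_def)
qed

text \<open>Both Wirtinger derivatives are again multiples of \<open>hecke_term\<close>, of
  exponents n - 1 and n + 1, so their variation along the segment is a first difference and
  \<open>hecke_diff1_bound\<close> applies to it.\<close>

lemma hecke_diff2_bound:
  obtains C where "C \<ge> 0" "\<And>s x \<omega>. cmod s \<le> B \<Longrightarrow> 2 * cmod \<omega> \<le> cmod x \<Longrightarrow> x \<noteq> 0 \<Longrightarrow>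
     cmod (hecke_diff2 n \<omega> s x) \<le> C * (cmod \<omega>)\<^sup>2 * cmod x powr (of_int n - Re s - 2)"
proof -
  obtain C1 where C1: "C1 \<ge> 0" "\<And>s x \<omega>. cmod s \<le> B \<Longrightarrow> 2 * cmod \<omega> \<le> cmod x \<Longrightarrow> x \<noteq> 0 \<Longrightarrow>
     cmod (hecke_diff1 (n - 1) \<omega> s x) \<le> C1 * cmod \<omega> * cmod x powr (of_int (n - 1) - Re s - 1)"
    using hecke_diff1_bound by blast
  obtain C2 where C2: "C2 \<ge> 0" "\<And>s x \<omega>. cmod s \<le> B + 2 \<Longrightarrow> 2 * cmod \<omega> \<le> cmod x \<Longrightarrow> x \<noteq> 0 \<Longrightarrow>
     cmod (hecke_diff1 (n + 1) \<omega> s x) \<le> C2 * cmod \<omega> * cmod x powr (of_int (n + 1) - Re s - 1)"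
    using hecke_diff1_bound by blast
  define C where "C = (\<bar>of_int n\<bar> + \<bar>B\<bar>) * C1 + \<bar>B\<bar> * C2"
  show ?thesis
  proof
    show "C \<ge> 0" using C1 C2 by (simp add: C_def)
    fix s x \<omega> :: complex
    assume s: "cmod s \<le> B" and w: "2 * cmod \<omega> \<le> cmod x" and x: "x \<noteq> 0"
    let ?d = "of_int n - Re s - 2"
    let ?y = "\<lambda>t. x + complex_of_real t * \<omega>"
    define D where "D t = \<omega> * hecke_d n s (?y t) + cnj \<omega> * hecke_dbar n s (?y t)" for t
    have *: "norm (D t - D 0) \<le> C * (cmod \<omega>)\<^sup>2 * cmod x powr ?d" if t: "t \<in> {0..1}" for t
    proof -
      note nb = norm_between[OF w, of t]
      have tw: "2 * cmod (of_real t * \<omega>) \<le> cmod x" using nb w t by auto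
      have 1: "cmod (hecke_diff1 (n - 1) (of_real t * \<omega>) s x) \<le> C1 * cmod \<omega> * cmod x powr ?d"
      proof -
        have "cmod (hecke_diff1 (n - 1) (of_real t * \<omega>) s x) \<le> C1 * cmod (of_real t * \<omega>) * cmod x powr ?d"
          using C1(2)[OF s tw x] by (simp add: algebra_simps)
        also have "\<dots> \<le> C1 * cmod \<omega> * cmod x powr ?d"
          using nb(3) t C1(1) by (intro mult_right_mono mult_left_mono) auto
        finally show ?thesis .
      qed
      have s2: "cmod (s + 2) \<le> B + 2" using norm_triangle_ineq[of s 2] s by simp
      have 2: "cmod (hecke_diff1 (n + 1) (of_real t * \<omega>) (s + 2) x) \<le> C2 * cmod \<omega> * cmod x powr ?d"
      proof -
        have "cmod (hecke_diff1 (n + 1) (of_real t * \<omega>) (s + 2) x) \<le> C2 * cmod (of_real t * \<omega>) * cmod x powr ?d"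
          using C2(2)[OF s2 tw x] by (simp add: algebra_simps)
        also have "\<dots> \<le> C2 * cmod \<omega> * cmod x powr ?d"
          using nb(3) t C2(1) by (intro mult_right_mono mult_left_mono) auto
        finally show ?thesis .
      qed
      have "cmod (of_int n - s / 2) \<le> \<bar>of_int n\<bar> + cmod s / 2"
        using norm_triangle_ineq4[of "of_int n" "s/2"] by (simp add: norm_divide)
      then have 3: "cmod (of_int n - s / 2) \<le> \<bar>of_int n\<bar> + \<bar>B\<bar>" using s norm_ge_zero[of s] by linarith
      have 4: "cmod (- (s / 2)) \<le> \<bar>B\<bar>" using s norm_ge_zero[of s] by (simp add: norm_divide)
      have D: "D t - D 0 = \<omega> * ((of_int n - s / 2) * hecke_diff1 (n - 1) (of_real t * \<omega>) s x)
                + cnj \<omega> * (- (s / 2) * hecke_diff1 (n + 1) (of_real t * \<omega>) (s + 2) x)"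
        by (simp add: D_def hecke_d_def hecke_dbar_def hecke_diff1_def algebra_simps)
      have "norm (D t - D 0) \<le> cmod \<omega> * ((\<bar>of_int n\<bar> + \<bar>B\<bar>) * (C1 * cmod \<omega> * cmod x powr ?d))
               + cmod \<omega> * (\<bar>B\<bar> * (C2 * cmod \<omega> * cmod x powr ?d))"
        unfolding D using 1 2 3 4
        by (intro norm_triangle_le add_mono) (simp_all only: norm_mult complex_mod_cnj, (intro mult_left_mono mult_mono; simp)+)
      then show ?thesis by (simp add: C_def algebra_simps power2_eq_square)
    qed
    have "norm (hecke_term n s (?y 1) - hecke_term n s (?y 0) - (1 - 0) *\<^sub>R D 0)
        \<le> norm (1 - 0 :: real) * (C * (cmod \<omega>)\<^sup>2 * cmod x powr ?d)"
    proof (rule vector_differentiable_bound_linearization[of "{0..1}"])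
      fix t :: real assume t: "t \<in> {0..1}"
      have "?y t \<noteq> 0" using norm_between[OF w, of t] t x by auto
      from hecke_term_deriv[OF this, of n s "{0..1}"]
      show "((\<lambda>t. hecke_term n s (?y t)) has_vector_derivative D t) (at t within {0..1})"
        by (simp add: D_def)
    qed (use * in \<open>auto simp: closed_segment_eq_real_ivl\<close>)
    then show "cmod (hecke_diff2 n \<omega> s x) \<le> C * (cmod \<omega>)\<^sup>2 * cmod x powr ?d"
      by (simp add: hecke_diff1_def hecke_diff2_def D_def)
  qed
qed

section \<open>Holomorphy in s of the lattice sums\<close>

context upper_half_point
begin

lemma lattice_sum_holomorphic:
  fixes f :: "complex \<Rightarrow> complex \<Rightarrow> complex"
  assumes hol: "\<And>x. (\<lambda>s. f s x) holomorphic_on {s. Re s > d + 2}"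
    and bd: "\<And>B. \<exists>C R. \<forall>s x. cmod s \<le> B \<longrightarrow> cmod x \<ge> R \<longrightarrow> x \<noteq> 0 \<longrightarrow> cmod (f s x) \<le> C * cmod x powr (d - Re s)"
  shows "(\<lambda>s. \<Sum>\<^sub>\<infinity>v. f s (u + lat v)) holomorphic_on {s. Re s > d + 2}"
    and "\<And>s. Re s > d + 2 \<Longrightarrow> (\<lambda>v. f s (u + lat v)) summable_on UNIV"
proof -
  have dom: "\<exists>e>0. \<exists>M Y. finite Y \<and> M summable_on UNIV \<and>
      (\<forall>v\<in>UNIV - Y. \<forall>t\<in>{s. Re s > d + 2}. dist s t \<le> e \<longrightarrow> cmod (f t (u + lat v)) \<le> M v)"
    if s: "s \<in> {s. Re s > d + 2}" for s
  proof -
    \<comment> \<open>Half the distance from s to the boundary: the decay exponent on the whole disc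
      is then at least r = 2 + e.\<close>
    define e where "e = (Re s - d - 2) / 2"
    have e: "e > 0" using s by (simp add: e_def)
    define r where "r = Re s - e - d"
    have r: "r > 2" using s by (simp add: r_def e_def field_simps)
    obtain C R where CR: "\<And>t x. cmod t \<le> cmod s + e \<Longrightarrow> cmod x \<ge> R \<Longrightarrow> x \<noteq> 0 \<Longrightarrow>
        cmod (f t x) \<le> C * cmod x powr (d - Re t)" using bd by blast
    \<comment> \<open>Beyond R the assumed bound holds; beyond 1 the powers of |x| are monotone in
      the exponent.\<close>
    define Y where "Y = {v. cmod (u + lat v) \<le> max R 1}"
    define M where "M v = \<bar>C\<bar> * cmod (u + lat v) powr (-r)" for v
    have "cmod (f t (u + lat v)) \<le> M v" if v: "v \<notin> Y" and t: "dist s t \<le> e" for v t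
    proof -
      let ?x = "cmod (u + lat v)"
      have x: "?x > R" "?x > 1" using v by (auto simp: Y_def)
      have t1: "cmod t \<le> cmod s + e"
        using t norm_triangle_ineq4[of s "s - t"] by (simp add: dist_norm)
      have t2: "Re t \<ge> Re s - e"
        using t abs_Re_le_cmod[of "s - t"] by (simp add: dist_norm)
      have "u + lat v \<noteq> 0" using x by auto
      then have "cmod (f t (u + lat v)) \<le> C * ?x powr (d - Re t)" using CR t1 x by auto
      also have "\<dots> \<le> \<bar>C\<bar> * ?x powr (-r)"
        using x t2 by (intro mult_mono powr_mono) (auto simp: r_def)
      finally show ?thesis by (simp add: M_def)
    qed
    moreover have "M summable_on UNIV"
      unfolding M_def by (intro summable_on_cmult_right summable_lat_powr r)
    moreover have "finite Y" unfolding Y_def by (rule finite_lat_ball)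
    ultimately show ?thesis using e by blast
  qed
  have op: "open {s. Re s > d + 2}" by (rule open_halfspace_Re_gt)
  show "(\<lambda>s. \<Sum>\<^sub>\<infinity>v. f s (u + lat v)) holomorphic_on {s. Re s > d + 2}"
    by (rule holomorphic_infsum(1)[OF op _ dom]) (use hol in auto)
  show "\<And>s. Re s > d + 2 \<Longrightarrow> (\<lambda>v. f s (u + lat v)) summable_on UNIV"
    by (rule holomorphic_infsum(2)[OF op _ dom]) (use hol in auto)
qed

lemma hecke_sum:
  shows "(\<lambda>s. \<Sum>\<^sub>\<infinity>v. hecke_term n s (u + lat v)) holomorphic_on {s. Re s > of_int n + 2}"
    and "\<And>s. Re s > of_int n + 2 \<Longrightarrow> (\<lambda>v. hecke_term n s (u + lat v)) summable_on UNIV"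
proof -
  have "\<exists>C R. \<forall>s x. cmod s \<le> B \<longrightarrow> cmod x \<ge> R \<longrightarrow> x \<noteq> 0 \<longrightarrow>
      cmod (hecke_term n s x) \<le> C * cmod x powr (of_int n - Re s)" for B
    by (intro exI[of _ 1]) (simp add: norm_hecke_term)
  note * = lattice_sum_holomorphic[of "hecke_term n" "of_int n", OF _ this]
  show "(\<lambda>s. \<Sum>\<^sub>\<infinity>v. hecke_term n s (u + lat v)) holomorphic_on {s. Re s > of_int n + 2}"
    by (rule *) (intro holomorphic_intros)
  show "\<And>s. Re s > of_int n + 2 \<Longrightarrow> (\<lambda>v. hecke_term n s (u + lat v)) summable_on UNIV"
    by (rule *) (intro holomorphic_intros)
qed

lemma hecke_diff1_sum:
  shows "(\<lambda>s. \<Sum>\<^sub>\<infinity>v. hecke_diff1 n \<omega> s (u + lat v)) holomorphic_on {s. Re s > of_int n + 1}"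
    and "\<And>s. Re s > of_int n + 1 \<Longrightarrow> (\<lambda>v. hecke_diff1 n \<omega> s (u + lat v)) summable_on UNIV"
proof -
  have "\<exists>C R. \<forall>s x. cmod s \<le> B \<longrightarrow> cmod x \<ge> R \<longrightarrow> x \<noteq> 0 \<longrightarrow>
      cmod (hecke_diff1 n \<omega> s x) \<le> C * cmod x powr (of_int n - 1 - Re s)" for B
  proof -
    obtain C where "\<And>s x \<omega>. cmod s \<le> B \<Longrightarrow> 2 * cmod \<omega> \<le> cmod x \<Longrightarrow> x \<noteq> 0 \<Longrightarrow>
     cmod (hecke_diff1 n \<omega> s x) \<le> C * cmod \<omega> * cmod x powr (of_int n - Re s - 1)"
      using hecke_diff1_bound[of B n] by metis
    then show ?thesis
      by (intro exI[of _ "C * cmod \<omega>"] exI[of _ "2 * cmod \<omega>"]) (simp add: algebra_simps)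
  qed
  note * = lattice_sum_holomorphic[of "hecke_diff1 n \<omega>" "of_int n - 1", OF holomorphic_hecke_diff1 this, simplified]
  show "(\<lambda>s. \<Sum>\<^sub>\<infinity>v. hecke_diff1 n \<omega> s (u + lat v)) holomorphic_on {s. Re s > of_int n + 1}"
    using *(1) by (simp add: algebra_simps)
  show "\<And>s. Re s > of_int n + 1 \<Longrightarrow> (\<lambda>v. hecke_diff1 n \<omega> s (u + lat v)) summable_on UNIV"
    using *(2) by (simp add: algebra_simps)
qed

text \<open>Each order of differencing moves the boundary by one, from n + 2 through n + 1 to n. For
  n = -1, the exponent of \<open>E_1\<close>, only this last half-plane contains s = 0.\<close>

lemma hecke_diff2_sum:
  shows "(\<lambda>s. \<Sum>\<^sub>\<infinity>v. hecke_diff2 n \<omega> s (u + lat v)) holomorphic_on {s. Re s > of_int n}"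
    and "\<And>s. Re s > of_int n \<Longrightarrow> (\<lambda>v. hecke_diff2 n \<omega> s (u + lat v)) summable_on UNIV"
proof -
  have "\<exists>C R. \<forall>s x. cmod s \<le> B \<longrightarrow> cmod x \<ge> R \<longrightarrow> x \<noteq> 0 \<longrightarrow>
      cmod (hecke_diff2 n \<omega> s x) \<le> C * cmod x powr (of_int n - 2 - Re s)" for B
  proof -
    obtain C where "\<And>s x \<omega>. cmod s \<le> B \<Longrightarrow> 2 * cmod \<omega> \<le> cmod x \<Longrightarrow> x \<noteq> 0 \<Longrightarrow>
     cmod (hecke_diff2 n \<omega> s x) \<le> C * (cmod \<omega>)\<^sup>2 * cmod x powr (of_int n - Re s - 2)"
      using hecke_diff2_bound[of B n] by metis
    then show ?thesis
      by (intro exI[of _ "C * (cmod \<omega>)\<^sup>2"] exI[of _ "2 * cmod \<omega>"]) (simp add: algebra_simps)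
  qed
  note * = lattice_sum_holomorphic[of "hecke_diff2 n \<omega>" "of_int n - 2", OF holomorphic_hecke_diff2 this, simplified]
  show "(\<lambda>s. \<Sum>\<^sub>\<infinity>v. hecke_diff2 n \<omega> s (u + lat v)) holomorphic_on {s. Re s > of_int n}"
    using *(1) by simp
  show "\<And>s. Re s > of_int n \<Longrightarrow> (\<lambda>v. hecke_diff2 n \<omega> s (u + lat v)) summable_on UNIV"
    using *(2) by simp
qed

definition hecke_series :: "int \<Rightarrow> complex \<Rightarrow> complex \<Rightarrow> complex"
  where "hecke_series n u s = (\<Sum>\<^sub>\<infinity>v. hecke_term n s (u + lat v))"

lemma hecke_series_periodic:
  assumes "\<omega> \<in> Lam"
  shows "hecke_series n (u + \<omega>) s = hecke_series n u s"
proof -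
  obtain w where w: "\<omega> = lat w" using assms by (auto simp: Lam_def)
  have "(\<Sum>\<^sub>\<infinity>v. hecke_term n s (u + lat (v + w))) = (\<Sum>\<^sub>\<infinity>v. hecke_term n s (u + lat v))"
    by (rule infsum_reindex_bij_betw) (rule bij_plus_right)
  then show ?thesis by (simp add: hecke_series_def lat_add w algebra_simps)
qed

text \<open>Summing a difference over a period telescopes to zero, so to first order the lattice sums
  of the two Wirtinger derivatives satisfy one linear relation for each period. The periods
  \<open>1\<close> and \<open>z\<close> give two independent relations, whose solution continues both sums.\<close>

lemma hecke_series_relation:
  assumes "\<omega> \<in> Lam" and s: "Re s > of_int n + 2"
  shows "\<omega> * ((of_int n - s / 2) * hecke_series (n - 1) u s) + cnj \<omega> * (- (s / 2) * hecke_series (n + 1) u (s + 2))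
    = - (\<Sum>\<^sub>\<infinity>v. hecke_diff2 n \<omega> s (u + lat v))"
proof -
  have 1: "((\<lambda>v. hecke_term n s (u + lat v)) has_sum hecke_series n u s) UNIV"
    unfolding hecke_series_def by (intro has_sum_infsum hecke_sum s)
  have "((\<lambda>v. hecke_term n s (u + \<omega> + lat v)) has_sum hecke_series n (u + \<omega>) s) UNIV"
    unfolding hecke_series_def by (intro has_sum_infsum hecke_sum s)
  then have 2: "((\<lambda>v. hecke_term n s (u + lat v + \<omega>)) has_sum hecke_series n u s) UNIV"
    unfolding hecke_series_periodic[OF assms(1)] by (simp add: add_ac)
  have 3: "((\<lambda>v. hecke_term (n - 1) s (u + lat v)) has_sum hecke_series (n - 1) u s) UNIV"
    unfolding hecke_series_def by (intro has_sum_infsum hecke_sum) (use s in simp)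
  have 4: "((\<lambda>v. hecke_term (n + 1) (s + 2) (u + lat v)) has_sum hecke_series (n + 1) u (s + 2)) UNIV"
    unfolding hecke_series_def by (intro has_sum_infsum hecke_sum) (use s in simp)
  have "((\<lambda>v. hecke_diff2 n \<omega> s (u + lat v)) has_sum
     ((hecke_series n u s - hecke_series n u s) - (\<omega> * ((of_int n - s / 2) * hecke_series (n - 1) u s) +
      cnj \<omega> * (- (s / 2) * hecke_series (n + 1) u (s + 2))))) UNIV"
    unfolding hecke_diff2_def hecke_diff1_def hecke_d_def hecke_dbar_def
    by (intro has_sum_diff has_sum_add has_sum_cmult_right 1 2 3 4)
  then show ?thesis by (simp add: infsumI)
qed

end

section \<open>Analytic continuation\<close>

lemma halfplane_identity:
  assumes "f holomorphic_on {s. Re s > a}" "g holomorphic_on {s. Re s > a}"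
    and eq: "\<And>s. Re s > b \<Longrightarrow> f s = g s" and "Re s > a"
  shows "f s = g s"
proof (rule analytic_continuation_open[of "{s. Re s > max a b}" "{s. Re s > a}" f g])
  have "complex_of_real (max a b + 1) \<in> {s. Re s > max a b}" by (simp add: max_def)
  then show "{s. Re s > max a b} \<noteq> {}" by blast
  show "open {s. Re s > max a b}" by (rule open_halfspace_Re_gt)
  show "connected {s. Re s > a}" by (intro convex_connected convex_halfspace_Re_gt)
qed (use assms in \<open>auto intro: open_halfspace_Re_gt\<close>)

lemma hecke_term_minus: "hecke_term n s (- x) = (-1) powi n * hecke_term n s x"
proof -
  have "(- x) powi n = (-1) powi n * x powi n"
    by (metis mult_minus1 power_int_mult_distrib)
  then show ?thesis by (simp add: hecke_term_def)
qed

text \<open>For x = 0 both sides are 0, because \<open>0 powi n = 0\<close> for negative n. With n =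
  0 the right-hand side would be 1 there.\<close>

lemma hecke_term_at_0: "n < 0 \<Longrightarrow> hecke_term n 0 x = x powi n"
  by (cases "x = 0") (auto simp: hecke_term_def powr_def)

context upper_half_point
begin

lemma hecke_series_holomorphic: "hecke_series n u holomorphic_on {s. Re s > of_int n + 2}"
  using hecke_sum(1)[of n u] by (simp add: hecke_series_def[abs_def])

lemma hecke_series_has_sum:
  "Re s > of_int n + 2 \<Longrightarrow> ((\<lambda>v. hecke_term n s (u + lat v)) has_sum hecke_series n u s) UNIV"
  unfolding hecke_series_def by (intro has_sum_infsum hecke_sum)

lemma hecke_series_minus: "hecke_series n (- u) s = (-1) powi n * hecke_series n u s"
proof -
  have "(\<Sum>\<^sub>\<infinity>v. hecke_term n s (- u + lat (- v))) = (\<Sum>\<^sub>\<infinity>v. hecke_term n s (- u + lat v))"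
    by (rule infsum_reindex_bij_betw) (rule bij_uminus)
  moreover have "hecke_term n s (- u + lat (- v)) = (-1) powi n * hecke_term n s (u + lat v)" for v
    by (simp add: lat_minus flip: hecke_term_minus)
  ultimately show ?thesis
    by (simp add: hecke_series_def infsum_cmult_right')
qed

definition diff2_sum :: "int \<Rightarrow> complex \<Rightarrow> complex \<Rightarrow> complex \<Rightarrow> complex"
  where "diff2_sum n u \<omega> s = (\<Sum>\<^sub>\<infinity>v. hecke_diff2 n \<omega> s (u + lat v))"

lemma diff2_sum_holomorphic: "diff2_sum n u \<omega> holomorphic_on {s. Re s > of_int n}"
  using hecke_diff2_sum(1)[of n \<omega> u] by (simp add: diff2_sum_def[abs_def])

text \<open>Cramer's rule for the relations with periods 1 and z, with determinant
  \<open>z - cnj z\<close>. Only remainder sums enter, so the quotient lives on Re s > n although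
  the relations are derived for Re s > n + 2.\<close>

definition d_sum :: "int \<Rightarrow> complex \<Rightarrow> complex \<Rightarrow> complex"
  where "d_sum n u s = (cnj z * diff2_sum n u 1 s - diff2_sum n u z s) / (z - cnj z)"

definition dbar_sum :: "int \<Rightarrow> complex \<Rightarrow> complex \<Rightarrow> complex"
  where "dbar_sum n u s = (diff2_sum n u z s - z * diff2_sum n u 1 s) / (z - cnj z)"

lemma d_sum_holomorphic: "d_sum n u holomorphic_on {s. Re s > of_int n}"
  and dbar_sum_holomorphic: "dbar_sum n u holomorphic_on {s. Re s > of_int n}"
  unfolding d_sum_def[abs_def] dbar_sum_def[abs_def]
  by (intro holomorphic_intros diff2_sum_holomorphic; use Im_pos in \<open>simp add: complex_eq_iff\<close>)+

lemma z_in_Lam: "z \<in> Lam" "1 \<in> Lam"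
proof -
  have "lat (1, 0) = z" "lat (0, 1) = 1" by (simp_all add: lat_def)
  then show "z \<in> Lam" "1 \<in> Lam" unfolding Lam_def by (metis rangeI)+
qed

lemma d_sum_eq_aux:
  assumes "Re s > of_int n + 2"
  shows "(of_int n - s / 2) * hecke_series (n - 1) u s = d_sum n u s"
    and "- (s / 2) * hecke_series (n + 1) u (s + 2) = dbar_sum n u s"
proof -
  define A where "A = (of_int n - s / 2) * hecke_series (n - 1) u s"
  define B where "B = - (s / 2) * hecke_series (n + 1) u (s + 2)"
  have 1: "A + B = - diff2_sum n u 1 s"
    using hecke_series_relation[OF z_in_Lam(2) assms, of u] by (simp add: A_def B_def diff2_sum_def)
  have 2: "z * A + cnj z * B = - diff2_sum n u z s"
    using hecke_series_relation[OF z_in_Lam(1) assms, of u] by (simp add: A_def B_def diff2_sum_def)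
  have nz: "z - cnj z \<noteq> 0" using Im_pos by (simp add: complex_eq_iff)
  have "(z - cnj z) * A = (z * A + cnj z * B) - cnj z * (A + B)" by (simp add: algebra_simps)
  also have "\<dots> = cnj z * diff2_sum n u 1 s - diff2_sum n u z s" unfolding 1 2 by simp
  finally show "A = d_sum n u s" using nz by (simp add: d_sum_def field_simps)
  have "(z - cnj z) * B = z * (A + B) - (z * A + cnj z * B)" by (simp add: algebra_simps)
  also have "\<dots> = diff2_sum n u z s - z * diff2_sum n u 1 s" unfolding 1 2 by simp
  finally show "B = dbar_sum n u s" using nz by (simp add: dbar_sum_def field_simps)
qed

text \<open>Telescoping needs the series of exponent n and hence Re s > n + 2. The series of
  exponent n - 1 converges one unit further, and the identity theorem closes this gap.\<close>

lemma d_sum_eq: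
  assumes "Re s > of_int n + 1"
  shows "(of_int n - s / 2) * hecke_series (n - 1) u s = d_sum n u s"
proof (rule halfplane_identity[where f = "\<lambda>s. (of_int n - s / 2) * hecke_series (n - 1) u s"
      and a = "of_int n + 1" and b = "of_int n + 2"])
  show "(\<lambda>s. (of_int n - s / 2) * hecke_series (n - 1) u s) holomorphic_on {s. Re s > of_int n + 1}"
    by (intro holomorphic_intros holomorphic_on_subset[OF hecke_series_holomorphic]) auto
  show "d_sum n u holomorphic_on {s. Re s > of_int n + 1}"
    by (rule holomorphic_on_subset[OF d_sum_holomorphic]) auto
qed (use d_sum_eq_aux assms in auto)

lemma dbar_sum_eq:
  assumes "Re s > of_int n + 1"
  shows "- (s / 2) * hecke_series (n + 1) u (s + 2) = dbar_sum n u s"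
proof (rule halfplane_identity[where f = "\<lambda>s. - (s / 2) * hecke_series (n + 1) u (s + 2)"
      and a = "of_int n + 1" and b = "of_int n + 2"])
  have "(hecke_series (n + 1) u \<circ> (\<lambda>s. s + 2)) holomorphic_on {s. Re s > of_int n + 1}"
    by (rule holomorphic_on_compose_gen[OF _ hecke_series_holomorphic]) (auto intro!: holomorphic_intros)
  then show "(\<lambda>s. - (s / 2) * hecke_series (n + 1) u (s + 2)) holomorphic_on {s. Re s > of_int n + 1}"
    by (intro holomorphic_intros) (auto simp: o_def)
  show "dbar_sum n u holomorphic_on {s. Re s > of_int n + 1}"
    by (rule holomorphic_on_subset[OF dbar_sum_holomorphic]) auto
qed (use d_sum_eq_aux assms in auto)

text \<open>For \<open>l \<ge> 2\<close> the term of exponent \<open>-l\<close> is a Wirtinger derivative of one of exponent \<open>1 - l\<close>,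
  up to the factor \<open>1 - l - s / 2\<close>, which does not vanish for \<open>Re s > 1 - l\<close>. For \<open>l = 1\<close> this
  factor vanishes at \<open>s = 0\<close>; there the series is expanded to first order at \<open>u = 0\<close>, where it
  vanishes by oddness.\<close>

definition hecke_cont :: "nat \<Rightarrow> complex \<Rightarrow> complex \<Rightarrow> complex"
  where "hecke_cont l u s =
    (if l = 1 then diff2_sum (- 1) 0 u s + u * d_sum (- 1) 0 s + cnj u * dbar_sum (- 1) 0 s
     else d_sum (1 - int l) u s / (of_int (1 - int l) - s / 2))"

definition hecke_value :: "nat \<Rightarrow> complex \<Rightarrow> complex"
  where "hecke_value l u = hecke_cont l u 0"

text \<open>This is \<open>\<pi>\<close> divided by the covolume of the lattice, but only its independence of the base point
  (lemma \<open>kappa_eq\<close>) matters.\<close>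

definition kappa :: complex where "kappa = - dbar_sum (- 1) 0 0"

text \<open>The boundary is -1 for l = 1 and 1 - l for l >= 2, so s = 0 is always inside.\<close>

lemma hecke_cont_holomorphic:
  assumes "l \<ge> 1"
  shows "hecke_cont l u holomorphic_on {s. Re s > min (-1) (1 - real l)}"
proof (cases "l = 1")
  case True
  then have "hecke_cont l u = (\<lambda>s. diff2_sum (- 1) 0 u s + u * d_sum (- 1) 0 s + cnj u * dbar_sum (- 1) 0 s)"
    by (simp add: fun_eq_iff hecke_cont_def)
  moreover have "{s. Re s > min (-1) (1 - real l)} = {s. Re s > of_int (- 1)}" using True by auto
  ultimately show ?thesis
    by (auto intro!: holomorphic_intros diff2_sum_holomorphic d_sum_holomorphic dbar_sum_holomorphic
        simp del: of_int_minus)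
next
  case False
  with assms have l: "l \<ge> 2" by simp
  have e: "hecke_cont l u = (\<lambda>s. d_sum (1 - int l) u s / (of_int (1 - int l) - s / 2))"
    using False by (simp add: fun_eq_iff hecke_cont_def)
  have d: "d_sum (1 - int l) u holomorphic_on {s. Re s > min (-1) (1 - real l)}"
    using d_sum_holomorphic[of "1 - int l" u] by (rule holomorphic_on_subset) (use l in auto)
  have "of_int (1 - int l) - s / 2 \<noteq> 0" if "Re s > min (-1) (1 - real l)" for s :: complex
  proof
    assume "of_int (1 - int l) - s / 2 = 0"
    then have "Re s = 2 - 2 * real l" by (simp add: complex_eq_iff)
    with that l show False by auto
  qed
  then show ?thesis unfolding e by (intro holomorphic_intros d) auto
qed

text \<open>Apart from the series at u, every summand on the right is holomorphic for Re s > -1.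
  Base point 0 justifies the definition of \<open>hecke_cont\<close> for l = 1; a general base point
  leads to \<open>hecke_value_1_shift\<close>.\<close>

lemma hecke_series_1_shift:
  assumes "Re s > 1"
  shows "hecke_series (-1) (u + \<omega>) s = hecke_series (-1) u s + diff2_sum (-1) u \<omega> s
           + \<omega> * d_sum (-1) u s + cnj \<omega> * dbar_sum (-1) u s"
proof -
  have 1: "((\<lambda>v. hecke_term (-1) s (u + \<omega> + lat v)) has_sum hecke_series (-1) (u + \<omega>) s) UNIV"
    by (rule hecke_series_has_sum) (use assms in simp)
  have 2: "((\<lambda>v. hecke_term (-1) s (u + lat v)) has_sum hecke_series (-1) u s) UNIV"
    by (rule hecke_series_has_sum) (use assms in simp)
  have 3: "((\<lambda>v. hecke_term (-1 - 1) s (u + lat v)) has_sum hecke_series (-1 - 1) u s) UNIV"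
    by (rule hecke_series_has_sum) (use assms in simp)
  have 4: "((\<lambda>v. hecke_term (-1 + 1) (s + 2) (u + lat v)) has_sum hecke_series (-1 + 1) u (s + 2)) UNIV"
    by (rule hecke_series_has_sum) (use assms in simp)
  have "((\<lambda>v. (hecke_term (-1) s (u + \<omega> + lat v) - hecke_term (-1) s (u + lat v)) -
          (\<omega> * ((of_int (-1) - s / 2) * hecke_term (-1 - 1) s (u + lat v)) +
           cnj \<omega> * (- (s / 2) * hecke_term (-1 + 1) (s + 2) (u + lat v)))) has_sum
      ((hecke_series (-1) (u + \<omega>) s - hecke_series (-1) u s) -
          (\<omega> * ((of_int (-1) - s / 2) * hecke_series (-1 - 1) u s) +
           cnj \<omega> * (- (s / 2) * hecke_series (-1 + 1) u (s + 2))))) UNIV"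
    by (intro has_sum_diff has_sum_add has_sum_cmult_right 1 2 3 4)
  moreover have "(\<lambda>v. (hecke_term (-1) s (u + \<omega> + lat v) - hecke_term (-1) s (u + lat v)) -
          (\<omega> * ((of_int (-1) - s / 2) * hecke_term (-1 - 1) s (u + lat v)) +
           cnj \<omega> * (- (s / 2) * hecke_term (-1 + 1) (s + 2) (u + lat v)))) =
        (\<lambda>v. hecke_diff2 (-1) \<omega> s (u + lat v))"
    by (simp add: fun_eq_iff hecke_diff2_def hecke_diff1_def hecke_d_def hecke_dbar_def add_ac)
  ultimately have "diff2_sum (-1) u \<omega> s = (hecke_series (-1) (u + \<omega>) s - hecke_series (-1) u s) -
          (\<omega> * ((of_int (-1) - s / 2) * hecke_series (-1 - 1) u s) +
           cnj \<omega> * (- (s / 2) * hecke_series (-1 + 1) u (s + 2)))"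
    by (simp add: diff2_sum_def infsumI)
  moreover have "(of_int (-1) - s / 2) * hecke_series (-1 - 1) u s = d_sum (-1) u s"
    by (rule d_sum_eq) (use assms in simp)
  moreover have "- (s / 2) * hecke_series (-1 + 1) u (s + 2) = dbar_sum (-1) u s"
    by (rule dbar_sum_eq) (use assms in simp)
  ultimately have "diff2_sum (-1) u \<omega> s = (hecke_series (-1) (u + \<omega>) s - hecke_series (-1) u s) -
          (\<omega> * d_sum (-1) u s + cnj \<omega> * dbar_sum (-1) u s)" by (simp only:)
  then show ?thesis by simp
qed

lemma hecke_cont_eq:
  assumes "l \<ge> 1" "Re s > 2 - real l"
  shows "hecke_cont l u s = hecke_series (- int l) u s"
proof (cases "l = 1")
  case True
  have "hecke_series (-1) (-0) s = (-1) powi (-1) * hecke_series (-1) 0 s"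
    by (rule hecke_series_minus)
  then have "hecke_series (-1) 0 s = 0" by simp
  then show ?thesis
    using hecke_series_1_shift[of s 0 u] assms True by (simp add: hecke_cont_def)
next
  case False
  with assms have l: "l \<ge> 2" by simp
  have "of_int (1 - int l) - s / 2 \<noteq> 0"
  proof
    assume "of_int (1 - int l) - s / 2 = 0"
    then have "Re s = 2 - 2 * real l" by (simp add: complex_eq_iff)
    with assms show False by auto
  qed
  moreover have "(of_int (1 - int l) - s / 2) * hecke_series (1 - int l - 1) u s = d_sum (1 - int l) u s"
    by (rule d_sum_eq) (use assms in simp)
  ultimately show ?thesis using False by (simp add: hecke_cont_def field_simps)
qed

lemma hecke_cont_unique:
  assumes l: "l \<ge> 1" and f: "f holomorphic_on {s. Re s > \<sigma>}" and \<sigma>: "\<sigma> < 2 - real l"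
    and eq: "\<And>s. Re s > b \<Longrightarrow> f s = hecke_series (- int l) u s" and s: "Re s > \<sigma>" "Re s > min (-1) (1 - real l)"
  shows "f s = hecke_cont l u s"
proof (rule halfplane_identity[of f "max \<sigma> (min (-1) (1 - real l))" _ "max b (2 - real l)"])
  show "f holomorphic_on {s. Re s > max \<sigma> (min (-1) (1 - real l))}"
    by (rule holomorphic_on_subset[OF f]) auto
  show "hecke_cont l u holomorphic_on {s. Re s > max \<sigma> (min (-1) (1 - real l))}"
    by (rule holomorphic_on_subset[OF hecke_cont_holomorphic[OF l]]) auto
qed (use s eq hecke_cont_eq[OF l] in auto)

text \<open>The device behind the identities that follow: a value at s = 0 is computed from any
  holomorphic function that agrees with the series for sufficiently large Re s.\<close>

lemma hecke_value_eqI: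
  assumes "l \<ge> 1" "f holomorphic_on {s. Re s > \<sigma>}" "\<sigma> < 2 - real l" "\<sigma> < 0"
    and "\<And>s. Re s > b \<Longrightarrow> f s = hecke_series (- int l) u s"
  shows "f 0 = hecke_value l u"
  unfolding hecke_value_def by (rule hecke_cont_unique[OF assms(1-3,5)]) (use assms in auto)

lemma hecke_value_periodic:
  assumes "l \<ge> 1" "\<omega> \<in> Lam"
  shows "hecke_value l (u + \<omega>) = hecke_value l u"
proof -
  have "hecke_cont l (u + \<omega>) 0 = hecke_value l u"
    by (rule hecke_value_eqI[OF assms(1) hecke_cont_holomorphic, where b = "2 - real l"])
       (use assms hecke_cont_eq hecke_series_periodic in auto)
  then show ?thesis by (simp add: hecke_value_def)
qed

lemma hecke_value_minus:
  assumes "l \<ge> 1"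
  shows "hecke_value l (- u) = (-1) ^ l * hecke_value l u"
proof -
  have "(-1) ^ l * hecke_cont l u 0 = hecke_value l (- u)"
  proof (rule hecke_value_eqI[OF assms, where f = "\<lambda>s. (-1) ^ l * hecke_cont l u s" and b = "2 - real l" and \<sigma> = "min (-1) (1 - real l)"])
    show "(\<lambda>s. (-1) ^ l * hecke_cont l u s) holomorphic_on {s. min (-1) (1 - real l) < Re s}"
      by (intro holomorphic_intros hecke_cont_holomorphic assms)
    show "(-1) ^ l * hecke_cont l u s = hecke_series (- int l) (- u) s" if "Re s > 2 - real l" for s
      using hecke_cont_eq[OF assms that] by (simp add: hecke_series_minus power_int_minus flip: power_inverse)
  qed (use assms in auto)
  then show ?thesis by (simp add: hecke_value_def)
qed

lemma hecke_value_1_Lam: "u \<in> Lam \<Longrightarrow> hecke_value 1 u = 0"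
  using hecke_value_periodic[of 1 u 0] hecke_value_minus[of 1 0] by simp

lemma hecke_value_series:
  assumes "l \<ge> 3"
  shows "((\<lambda>v. (u + lat v) powi (- int l)) has_sum hecke_value l u) UNIV"
proof -
  have "hecke_value l u = hecke_series (- int l) u 0"
    unfolding hecke_value_def by (rule hecke_cont_eq) (use assms in auto)
  then show ?thesis
    using hecke_series_has_sum[of "- int l" 0 u] assms by (simp add: hecke_term_at_0)
qed

text \<open>The point is l = 2: first differences converge for Re s > 1 - l, which includes s = 0,
  while the series itself needs Re s > 2 - l.\<close>

lemma hecke_value_diff:
  assumes "l \<ge> 2"
  shows "((\<lambda>v. (u + \<omega> + lat v) powi (- int l) - (u + lat v) powi (- int l)) has_sum
           hecke_value l (u + \<omega>) - hecke_value l u) UNIV"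
proof -
  define f where "f s = hecke_cont l u s + (\<Sum>\<^sub>\<infinity>v. hecke_diff1 (- int l) \<omega> s (u + lat v))" for s
  have "f 0 = hecke_value l (u + \<omega>)"
  proof (rule hecke_value_eqI[where f = f and b = "2 - real l" and \<sigma> = "1 - real l"])
    have "hecke_cont l u holomorphic_on {s. Re s > 1 - real l}"
      by (rule holomorphic_on_subset[OF hecke_cont_holomorphic]) (use assms in auto)
    moreover have "(\<lambda>s. \<Sum>\<^sub>\<infinity>v. hecke_diff1 (- int l) \<omega> s (u + lat v)) holomorphic_on {s. Re s > 1 - real l}"
      using hecke_diff1_sum(1)[of "- int l" \<omega> u] by (rule holomorphic_on_subset) auto
    ultimately show "f holomorphic_on {s. Re s > 1 - real l}"
      unfolding f_def[abs_def] by (rule holomorphic_on_add)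
    fix s :: complex assume s: "Re s > 2 - real l"
    have "((\<lambda>v. hecke_term (- int l) s (u + \<omega> + lat v) - hecke_term (- int l) s (u + lat v)) has_sum
       (hecke_series (- int l) (u + \<omega>) s - hecke_series (- int l) u s)) UNIV"
      by (intro has_sum_diff hecke_series_has_sum) (use s in auto)
    then have "(\<Sum>\<^sub>\<infinity>v. hecke_diff1 (- int l) \<omega> s (u + lat v)) = hecke_series (- int l) (u + \<omega>) s - hecke_series (- int l) u s"
      by (simp add: hecke_diff1_def infsumI add_ac)
    then show "f s = hecke_series (- int l) (u + \<omega>) s"
      using hecke_cont_eq[of l s u] s assms by (simp add: f_def)
  qed (use assms in auto)
  then have "(\<Sum>\<^sub>\<infinity>v. hecke_diff1 (- int l) \<omega> 0 (u + lat v)) = hecke_value l (u + \<omega>) - hecke_value l u"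
    by (simp add: f_def hecke_value_def algebra_simps)
  moreover have "((\<lambda>v. hecke_diff1 (- int l) \<omega> 0 (u + lat v)) has_sum (\<Sum>\<^sub>\<infinity>v. hecke_diff1 (- int l) \<omega> 0 (u + lat v))) UNIV"
    by (rule has_sum_infsum, rule hecke_diff1_sum) (use assms in auto)
  ultimately show ?thesis
    using assms by (simp add: hecke_diff1_def hecke_term_at_0 add_ac)
qed

text \<open>Changing the base point alters the sum of |x|^(-s-2) by a series of differences, which
  is holomorphic near s = 0. The factor -s/2 removes it at s = 0, so only the residue matters, and
  that is the same for all u.\<close>

lemma kappa_eq: "dbar_sum (-1) u 0 = - kappa"
proof -
  define f where "f s = dbar_sum (-1) 0 s + - (s / 2) * (\<Sum>\<^sub>\<infinity>v. hecke_diff1 0 u (s + 2) (lat v))" for s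
  have "dbar_sum (-1) u 0 = f 0"
  proof (rule halfplane_identity[where f = "dbar_sum (-1) u" and g = f and a = "-1" and b = 0])
    show "dbar_sum (-1) u holomorphic_on {s. Re s > - 1}"
      using dbar_sum_holomorphic[of "-1" u] by simp
    have "((\<lambda>s. \<Sum>\<^sub>\<infinity>v. hecke_diff1 0 u s (0 + lat v)) \<circ> (\<lambda>s. s + 2)) holomorphic_on {s. Re s > - 1}"
      by (rule holomorphic_on_compose_gen[OF _ hecke_diff1_sum(1)]) (auto intro!: holomorphic_intros)
    then show "f holomorphic_on {s. Re s > - 1}"
      unfolding f_def[abs_def] using dbar_sum_holomorphic[of "-1" 0]
      by (intro holomorphic_intros) (auto simp: o_def)
    fix s :: complex assume s: "Re s > 0"
    have "((\<lambda>v. hecke_term 0 (s + 2) (u + lat v) - hecke_term 0 (s + 2) (0 + lat v)) has_sum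
       (hecke_series 0 u (s + 2) - hecke_series 0 0 (s + 2))) UNIV"
      by (intro has_sum_diff hecke_series_has_sum) (use s in auto)
    then have "hecke_series 0 u (s + 2) = hecke_series 0 0 (s + 2) + (\<Sum>\<^sub>\<infinity>v. hecke_diff1 0 u (s + 2) (lat v))"
      by (simp add: hecke_diff1_def infsumI add_ac)
    moreover have "dbar_sum (-1) u s = - (s / 2) * hecke_series (-1 + 1) u (s + 2)"
      "dbar_sum (-1) 0 s = - (s / 2) * hecke_series (-1 + 1) 0 (s + 2)"
      by (rule dbar_sum_eq[symmetric]; use s in simp)+
    ultimately show "dbar_sum (-1) u s = f s" by (simp add: f_def algebra_simps)
  qed auto
  then show ?thesis by (simp add: f_def kappa_def)
qed

text \<open>The series on the left is the one of the Weierstrass zeta function, expanded at u and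
  holomorphic in \<omega> away from its poles. Thus \<open>cnj \<omega> * kappa\<close> is exactly
  the failure of \<open>E_1\<close> to be meromorphic.\<close>

lemma hecke_value_1_shift:
  "((\<lambda>v. inverse (u + \<omega> + lat v) - inverse (u + lat v) + \<omega> * inverse ((u + lat v)\<^sup>2)) has_sum
      hecke_value 1 (u + \<omega>) - hecke_value 1 u + \<omega> * hecke_value 2 u + cnj \<omega> * kappa) UNIV"
proof -
  define f where "f s = hecke_cont 1 u s + diff2_sum (-1) u \<omega> s
           + \<omega> * d_sum (-1) u s + cnj \<omega> * dbar_sum (-1) u s" for s
  have "f 0 = hecke_value 1 (u + \<omega>)"
  proof (rule hecke_value_eqI[where f = f and b = 1 and \<sigma> = "-1"])
    have "hecke_cont 1 u holomorphic_on {s. Re s > - 1}"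
      using hecke_cont_holomorphic[of 1 u] by simp
    then show "f holomorphic_on {s. Re s > - 1}"
      unfolding f_def[abs_def]
      using diff2_sum_holomorphic[of "-1" u \<omega>] d_sum_holomorphic[of "-1" u] dbar_sum_holomorphic[of "-1" u]
      by (intro holomorphic_intros) auto
    show "f s = hecke_series (- int 1) (u + \<omega>) s" if "Re s > 1" for s
      using hecke_series_1_shift[OF that, of u \<omega>] hecke_cont_eq[of 1 s u] that by (simp add: f_def)
  qed auto
  moreover have "d_sum (-1) u 0 = - hecke_value 2 u"
    by (simp add: hecke_value_def hecke_cont_def)
  ultimately have "diff2_sum (-1) u \<omega> 0 = hecke_value 1 (u + \<omega>) - hecke_value 1 u + \<omega> * hecke_value 2 u + cnj \<omega> * kappa"
    by (simp add: f_def kappa_eq algebra_simps hecke_value_def)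
  moreover have "((\<lambda>v. hecke_diff2 (-1) \<omega> 0 (u + lat v)) has_sum diff2_sum (-1) u \<omega> 0) UNIV"
    unfolding diff2_sum_def by (intro has_sum_infsum hecke_diff2_sum) auto
  ultimately show ?thesis
    by (simp add: hecke_diff2_def hecke_diff1_def hecke_d_def hecke_dbar_def hecke_term_at_0 add_ac
        power_int_minus)
qed

section \<open>Identification with the Eisenstein series\<close>

lemma eisenstein_series_eq:
  assumes l: "l \<ge> 1"
  shows "eisenstein_series l lam z s =
    hecke_series (- int l) (of_rat (fst lam) * z + of_rat (snd lam)) s * complex_of_real (Im z) powr (s / 2)"
proof -
  define u where "u = of_rat (fst lam) * z + of_rat (snd lam)"
  define g where "g w = of_rat (fst w) * z + of_rat (snd w)" for w :: "rat \<times> rat"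
  define j where "j v = (fst lam + of_int (fst v), snd lam + of_int (snd v))" for v :: "int \<times> int"
  have gj: "g (j v) = u + lat v" for v
    by (simp add: g_def j_def u_def lat_def of_rat_add algebra_simps)
  have "hecke_series (- int l) u s = (\<Sum>\<^sub>\<infinity>v. hecke_term (- int l) s (g (j v)))"
    by (simp add: hecke_series_def gj)
  also have "\<dots> = (\<Sum>\<^sub>\<infinity>w\<in>{w. w - lam \<in> \<int> \<times> \<int>}. hecke_term (- int l) s (g w))"
  proof (rule infsum_reindex_bij_betw[where f = "\<lambda>w. hecke_term (- int l) s (g w)" and g = j])
    show "bij_betw j UNIV {w. w - lam \<in> \<int> \<times> \<int>}"
      unfolding bij_betw_def
    proof
      show "inj j" by (auto simp: j_def inj_def)
      show "range j = {w. w - lam \<in> \<int> \<times> \<int>}"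
      proof (intro equalityI subsetI)
        fix w assume "w \<in> {w. w - lam \<in> \<int> \<times> \<int>}"
        then obtain m n where "fst w - fst lam = of_int m" "snd w - snd lam = of_int n"
          by (auto elim!: Ints_cases simp: minus_prod_def)
        then have "w = j (m, n)" by (simp add: j_def prod_eq_iff algebra_simps)
        then show "w \<in> range j" by (metis rangeI)
      qed (auto simp: j_def minus_prod_def)
    qed
  qed
  \<comment> \<open>The origin, excluded from the Eisenstein series, contributes 0 to the Hecke
    series.\<close>
  also have "\<dots> = (\<Sum>\<^sub>\<infinity>w\<in>{w. w - lam \<in> \<int> \<times> \<int> \<and> w \<noteq> (0, 0)}. hecke_term (- int l) s (g w))"
    by (rule infsum_cong_neutral) (auto simp: g_def)
  finally have "hecke_series (- int l) u s * complex_of_real (Im z) powr (s / 2) =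
    (\<Sum>\<^sub>\<infinity>w\<in>{w. w - lam \<in> \<int> \<times> \<int> \<and> w \<noteq> (0, 0)}. hecke_term (- int l) s (g w) * complex_of_real (Im z) powr (s / 2))"
    by (simp add: infsum_cmult_left')
  then show ?thesis
    unfolding eisenstein_series_def u_def
    by (simp add: hecke_term_def g_def case_prod_unfold)
qed

text \<open>The remaining factor y^(s/2) is entire in s and equals 1 at s = 0.\<close>

lemma eisenstein_eq_hecke_value:
  assumes l: "l \<ge> 1"
  shows "eisenstein l lam z = hecke_value l (of_rat (fst lam) * z + of_rat (snd lam))"
proof -
  define u where "u = of_rat (fst lam) * z + of_rat (snd lam)"
  define f where "f s = hecke_cont l u s * complex_of_real (Im z) powr (s / 2)" for s
  have fe: "f = (\<lambda>s. hecke_cont l u s * exp (s / 2 * ln (complex_of_real (Im z))))"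
    using Im_pos by (auto simp: fun_eq_iff f_def powr_def)
  have "eisenstein_continuation_value l lam z 0 (hecke_value l u)"
    unfolding eisenstein_continuation_value_def
  proof (intro exI conjI allI impI)
    show "min (-1) (1 - real l) < Re 0" "min (-1) (1 - real l) < 2 - real l" by auto
    show "f holomorphic_on {t. Re t > min (-1) (1 - real l)}"
      unfolding fe by (intro holomorphic_intros hecke_cont_holomorphic l) auto
    show "f t = eisenstein_series l lam z t" if "Re t + real l > 2" for t
      using that l by (simp add: eisenstein_series_eq f_def u_def hecke_cont_eq)
    show "f 0 = hecke_value l u"
      by (simp add: fe hecke_value_def)
  qed
  then show ?thesis
    unfolding eisenstein_def eisenstein_s_def u_def[symmetric]
    using eisenstein_continuation_value_unique by (intro the_equality) blast+
qed

end

section \<open>Generating functions and the addition theorem\<close>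

text \<open>Geometric series in t / x. The subtracted terms are those of
  \<open>hecke_value_1_shift\<close> and \<open>hecke_value_diff\<close> with \<omega> = -t, leaving
  only powers x^(-m) with m >= 3, whose lattice sums converge. The second formula is multiplied by t
  so that both fit \<open>lattice_double_sum\<close>.\<close>

lemma kernel_expansion:
  fixes x t :: complex
  assumes "2 * cmod t \<le> cmod x" "x \<noteq> 0"
  shows "((\<lambda>n. t ^ (n + 2) * x powi (- int (n + 3))) has_sum
            inverse (x - t) - inverse x - t * inverse (x\<^sup>2)) UNIV"
    and "((\<lambda>n. of_nat (n + 2) * (t ^ (n + 2) * x powi (- int (n + 3)))) has_sum
            t * (inverse ((x - t)\<^sup>2) - inverse (x\<^sup>2))) UNIV"
proof -
  define q where "q = t / x"
  have q: "cmod q \<le> 1 / 2" using assms by (simp add: q_def norm_divide field_simps)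
  have xt: "x - t \<noteq> 0"
  proof
    assume "x - t = 0"
    then have "x = t" by simp
    with assms show False by auto
  qed
  have q1: "1 - q \<noteq> 0" using xt assms(2) by (simp add: q_def field_simps)
  have e: "t ^ (n + 2) * x powi (- int (n + 3)) = t\<^sup>2 / x ^ 3 * q ^ n" for n
  proof -
    have "x powi (- int (n + 3)) = inverse (x ^ (n + 3))"
      by (simp only: power_int_minus power_int_of_nat)
    then show ?thesis
      using assms(2) by (simp add: q_def power_add power_divide field_simps power2_eq_square)
  qed
  have s1: "(\<lambda>n. q ^ n) sums (1 / (1 - q))" using q by (intro geometric_sums) simp
  have s2: "(\<lambda>n. of_nat (Suc n) * q ^ n) sums (1 / (1 - q)^2)" using q by (intro geometric_deriv_sums) simp
  have n1: "summable (\<lambda>n. cmod (q ^ n))"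
    using q by (simp add: norm_power)
  have n2: "summable (\<lambda>n. cmod (of_nat (Suc n) * q ^ n))"
    using geometric_deriv_sums[of "cmod q"] q by (simp add: norm_mult norm_power sums_iff del: of_nat_Suc)
  have s3: "(\<lambda>n. of_nat (n + 2) * q ^ n) sums (1 / (1 - q)^2 + 1 / (1 - q))"
    using sums_add[OF s2 s1] by (simp add: algebra_simps)
  have n3: "summable (\<lambda>n. cmod (of_nat (n + 2) * q ^ n))"
  proof (rule summable_comparison_test'[OF summable_add[OF n2 n1]])
    fix n :: nat assume "n \<ge> 0"
    have "of_nat (n + 2) * q ^ n = of_nat (Suc n) * q ^ n + q ^ n" by (simp add: algebra_simps)
    then show "norm (cmod (of_nat (n + 2) * q ^ n)) \<le> cmod (of_nat (Suc n) * q ^ n) + cmod (q ^ n)"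
      by (simp only: real_norm_def abs_norm_cancel norm_triangle_ineq)
  qed
  have h1: "((\<lambda>n. q ^ n) has_sum (1 / (1 - q))) UNIV"
    by (rule norm_summable_imp_has_sum[OF n1 s1])
  have h3: "((\<lambda>n. of_nat (n + 2) * q ^ n) has_sum (1 / (1 - q)^2 + 1 / (1 - q))) UNIV"
    by (rule norm_summable_imp_has_sum[OF n3 s3])
  have v0: "1 / (1 - q) = x / (x - t)"
    using assms(2) xt q1 by (simp add: q_def field_simps)
  have v1: "t\<^sup>2 / x ^ 3 * (1 / (1 - q)) = inverse (x - t) - inverse x - t * inverse (x\<^sup>2)"
    unfolding v0 using assms(2) xt by (simp add: field_simps power2_eq_square power3_eq_cube)
  have v2: "1 / (1 - q)^2 = (x / (x - t))\<^sup>2" unfolding v0[symmetric] by (simp add: power_divide)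
  have v3: "t\<^sup>2 / x ^ 3 * (1 / (1 - q)^2 + 1 / (1 - q)) = t * (inverse ((x - t)\<^sup>2) - inverse (x\<^sup>2))"
  proof -
    \<comment> \<open>With y = x - t as a variable both denominators are atomic for the field
      simplification.\<close>
    have "(x - y)\<^sup>2 / x ^ 3 * ((x / y)\<^sup>2 + x / y) = (x - y) * (inverse (y\<^sup>2) - inverse (x\<^sup>2))" if "y \<noteq> 0" for y
      using assms(2) that by (simp add: field_simps power2_eq_square power3_eq_cube)
    from this[OF xt] show ?thesis unfolding v2 v0 by simp
  qed
  show "((\<lambda>n. t ^ (n + 2) * x powi (- int (n + 3))) has_sum
            inverse (x - t) - inverse x - t * inverse (x\<^sup>2)) UNIV"
    using has_sum_cmult_right[OF h1, of "t\<^sup>2 / x ^ 3"] unfolding e v1 .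
  have c: "of_nat (n + 2) * (t\<^sup>2 / x ^ 3 * q ^ n) = t\<^sup>2 / x ^ 3 * (of_nat (n + 2) * q ^ n)" for n
    by (simp only: mult_ac)
  show "((\<lambda>n. of_nat (n + 2) * (t ^ (n + 2) * x powi (- int (n + 3)))) has_sum
            t * (inverse ((x - t)\<^sup>2) - inverse (x\<^sup>2))) UNIV"
    using has_sum_cmult_right[OF h3, of "t\<^sup>2 / x ^ 3"] unfolding e v3 c .
qed

context upper_half_point
begin

lemma lat_gap: obtains \<rho> where "\<rho> > 0" "\<And>v. u + lat v \<noteq> 0 \<Longrightarrow> \<rho> \<le> cmod (u + lat v)"
proof -
  define A where "A = (\<lambda>v. cmod (u + lat v)) ` {v. cmod (u + lat v) \<le> 1} - {0}"
  have A: "finite A" unfolding A_def by (intro finite_Diff finite_imageI finite_lat_ball)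
  define \<rho> where "\<rho> = Min (insert 1 A)"
  have "\<rho> > 0" unfolding \<rho>_def using A by (subst Min_gr_iff) (auto simp: A_def)
  moreover have "\<rho> \<le> cmod (u + lat v)" if "u + lat v \<noteq> 0" for v
  proof (cases "cmod (u + lat v) \<le> 1")
    case True
    then have "cmod (u + lat v) \<in> A" using that by (auto simp: A_def)
    then show ?thesis unfolding \<rho>_def using A by (intro Min_le) auto
  next
    case False
    have "\<rho> \<le> 1" unfolding \<rho>_def using A by (intro Min_le) auto
    with False show ?thesis by simp
  qed
  ultimately show ?thesis using that by blast
qed

lemma eventually_notin_Lam:
  "\<exists>e>0. \<forall>t. cmod t < e \<longrightarrow> t \<noteq> 0 \<longrightarrow> u - t \<notin> Lam"
proof -
  obtain \<rho> where \<rho>: "\<rho> > 0" "\<And>v. u + lat v \<noteq> 0 \<Longrightarrow> \<rho> \<le> cmod (u + lat v)" using lat_gap by blast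
  have "u - t \<notin> Lam" if t: "cmod t < \<rho>" "t \<noteq> 0" for t
  proof
    assume "u - t \<in> Lam"
    then obtain v where v: "u - t = lat v" by (auto simp: Lam_def)
    then have "u + lat (- v) = t" by (simp add: lat_minus algebra_simps)
    then show False using \<rho>(2)[of "- v"] t by simp
  qed
  then show ?thesis using \<rho>(1) by blast
qed

definition in_Lam :: "complex \<Rightarrow> complex" where "in_Lam u = (if u \<in> Lam then 1 else 0)"

text \<open>Fubini for the sum over lattice points and powers of t. If u lies in \<Lambda>, the row
  of the point u + lat v = 0 consists of zeros although \<open>g 0\<close> is -1/t or 1/t in the two
  applications; the correction \<open>in_Lam u * g 0\<close> is the origin of the pole terms in
  \<open>reg1\<close> and \<open>reg2\<close>.\<close>

lemma lattice_double_sum: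
  assumes \<rho>: "\<And>v. u + lat v \<noteq> 0 \<Longrightarrow> \<rho> \<le> cmod (u + lat v)" and t: "2 * cmod t \<le> \<rho>"
    and c: "\<And>n. cmod (c n) \<le> real (n + 2)"
    and g: "\<And>v. u + lat v \<noteq> 0 \<Longrightarrow>
      ((\<lambda>n. c n * (t ^ (n + 2) * (u + lat v) powi (- int (n + 3)))) has_sum g (u + lat v)) UNIV"
    and S: "((\<lambda>v. g (u + lat v)) has_sum S) UNIV"
  shows "(\<lambda>n. c n * (t ^ (n + 2) * hecke_value (n + 3) u)) sums (S - in_Lam u * g 0)"
proof -
  define F where "F = (\<lambda>(v, n). c n * (t ^ (n + 2) * (u + lat v) powi (- int (n + 3))))"
  define g' where "g' v = (if u + lat v = 0 then 0 else g (u + lat v))" for v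
  have z: "((\<lambda>v. if u + lat v = 0 then g 0 else 0) has_sum in_Lam u * g 0) UNIV"
  proof (cases "u \<in> Lam")
    case True
    then obtain w where w: "u = lat w" by (auto simp: Lam_def)
    have i: "u + lat v = 0 \<longleftrightarrow> v = - w" for v
      by (metis ab_left_minus add.commute add_left_cancel lat_add lat_eq_0_iff w add_eq_0_iff)
    show ?thesis by (rule has_sum_finite_neutralI[of "{- w}"]) (auto simp: i True in_Lam_def)
  next
    case False
    then have i: "u + lat v \<noteq> 0" for v
      by (metis Lam_closed(4) Lam_def add_eq_0_iff2 rangeI)
    show ?thesis using False by (simp add: i in_Lam_def)
  qed
  have "((\<lambda>v. g (u + lat v) - (if u + lat v = 0 then g 0 else 0)) has_sum (S - in_Lam u * g 0)) UNIV"
    by (rule has_sum_diff[OF S z])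
  then have S': "(g' has_sum (S - in_Lam u * g 0)) UNIV"
    by (rule has_sum_cong[THEN iffD1, rotated]) (auto simp: g'_def)
  have row: "((\<lambda>n. F (v, n)) has_sum g' v) UNIV" for v
    using g[of v] by (auto simp: F_def g'_def)
  \<comment> \<open>Since |t| / |x| <= 1/2, the double series has a majorant that is a product of a
    function of v and a function of n.\<close>
  have bound: "cmod (F (v, n)) \<le> ((cmod t)\<^sup>2 * cmod (u + lat v) powr -3) * (real (n + 2) * (1/2) ^ n)" for v n
  proof (cases "u + lat v = 0")
    case False
    let ?x = "cmod (u + lat v)"
    have x: "?x > 0" "2 * cmod t \<le> ?x" using False \<rho>[OF False] t by auto
    have "cmod (F (v, n)) = cmod (c n) * (cmod t ^ (n + 2) * ?x powi (- int (n + 3)))"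
      by (simp add: F_def norm_mult norm_power norm_power_int)
    also have "?x powi (- int (n + 3)) = ?x powr -3 * (1 / ?x) ^ n"
    proof -
      have "?x powi (- int (n + 3)) = inverse (?x ^ (n + 3))"
        by (simp only: power_int_minus power_int_of_nat)
      also have "\<dots> = inverse (?x ^ 3) * (1 / ?x) ^ n"
        by (simp add: power_add power_inverse divide_inverse)
      also have "inverse (?x ^ 3) = ?x powr -3"
        using x(1) by (simp add: powr_minus)
      finally show ?thesis .
    qed
    also have "cmod (c n) * (cmod t ^ (n + 2) * (?x powr -3 * (1 / ?x) ^ n))
        = ((cmod t)\<^sup>2 * ?x powr -3) * (cmod (c n) * (cmod t / ?x) ^ n)"
      by (simp add: power_add power_divide power2_eq_square)
    also have "\<dots> \<le> ((cmod t)\<^sup>2 * ?x powr -3) * (real (n + 2) * (1/2) ^ n)"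
      using x by (intro mult_left_mono mult_mono c power_mono) (auto simp: field_simps)
    finally show ?thesis .
  next
    case True
    then show ?thesis by (simp add: F_def)
  qed
  have sn: "(\<lambda>n. real (n + 2) * (1/2) ^ n) summable_on UNIV"
  proof (rule summable_nonneg_imp_summable_on)
    have "summable (\<lambda>n. of_nat (Suc n) * (1/2::real) ^ n + (1/2) ^ n)"
      by (intro summable_add summable_geometric sums_summable[OF geometric_deriv_sums]) auto
    then show "summable (\<lambda>n. real (n + 2) * (1/2) ^ n)" by (simp add: algebra_simps)
  qed auto
  have sv: "(\<lambda>v. (cmod t)\<^sup>2 * cmod (u + lat v) powr -3) summable_on UNIV"
    by (intro summable_on_cmult_right summable_lat_powr) simp
  have "(\<lambda>(v, n). ((cmod t)\<^sup>2 * cmod (u + lat v) powr -3) * (real (n + 2) * (1/2) ^ n)) summable_on (UNIV \<times> UNIV)"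
  proof (rule summable_on_SigmaI)
    show "((\<lambda>n. case (v, n) of (v, n) \<Rightarrow> ((cmod t)\<^sup>2 * cmod (u + lat v) powr -3) * (real (n + 2) * (1/2) ^ n)) has_sum
       ((cmod t)\<^sup>2 * cmod (u + lat v) powr -3) * infsum (\<lambda>n. real (n + 2) * (1/2) ^ n) UNIV) UNIV" for v
      unfolding prod.case by (intro has_sum_cmult_right has_sum_infsum sn)
  next
    show "(\<lambda>v. ((cmod t)\<^sup>2 * cmod (u + lat v) powr -3) * infsum (\<lambda>n. real (n + 2) * (1/2) ^ n) UNIV) summable_on UNIV"
      by (intro summable_on_cmult_left sv)
  qed auto
  then have "(\<lambda>p. norm (F p)) summable_on (UNIV \<times> UNIV)"
  proof (rule Infinite_Sum.abs_summable_on_comparison_test')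
    fix p :: "(int \<times> int) \<times> nat"
    show "norm (F p) \<le> (case p of (v, n) \<Rightarrow> ((cmod t)\<^sup>2 * cmod (u + lat v) powr -3) * (real (n + 2) * (1/2) ^ n))"
      by (cases p) (simp only: prod.case bound)
  qed
  then have sF: "F summable_on (UNIV \<times> UNIV)"
    by (rule abs_summable_summable)
  then obtain P where P: "(F has_sum P) (UNIV \<times> UNIV)" by (auto simp: summable_on_def)
  have "(g' has_sum P) UNIV" by (rule has_sum_SigmaD[OF P]) (rule row)
  with S' have PS: "P = S - in_Lam u * g 0" by (rule has_sum_unique[symmetric])
  have "((\<lambda>(n, v). F (v, n)) has_sum P) (UNIV \<times> UNIV)" using P by (subst (asm) has_sum_swap)
  then have "((\<lambda>n. c n * (t ^ (n + 2) * hecke_value (n + 3) u)) has_sum P) UNIV"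
  proof (rule has_sum_SigmaD)
    show "((\<lambda>v. case (n, v) of (n, v) \<Rightarrow> F (v, n)) has_sum c n * (t ^ (n + 2) * hecke_value (n + 3) u)) UNIV" for n
      unfolding F_def prod.case by (intro has_sum_cmult_right hecke_value_series) simp
  qed
  then show ?thesis unfolding PS by (rule has_sum_imp_sums)
qed

text \<open>\<open>reg1\<close> and \<open>reg2\<close> are \<open>E\<^sub>1(u - t)\<close> and \<open>E\<^sub>2(u - t)\<close> without antiholomorphic term and without the
  pole at \<open>t = 0\<close>. As \<open>x / 0 = 0\<close>, their values at \<open>t = 0\<close> are \<open>E\<^sub>1(u)\<close> and \<open>E\<^sub>2(u)\<close>, which are the
  constant terms of the expansions also for \<open>u\<close> in the lattice.\<close>

definition gen :: "complex \<Rightarrow> complex fps"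
  where "gen u = Abs_fps (\<lambda>n. hecke_value (n + 1) u)"

definition reg1 :: "complex \<Rightarrow> complex \<Rightarrow> complex"
  where "reg1 u t = hecke_value 1 (u - t) - cnj t * kappa + in_Lam u / t"

definition reg2 :: "complex \<Rightarrow> complex \<Rightarrow> complex"
  where "reg2 u t = hecke_value 2 (u - t) - in_Lam u / t\<^sup>2"

text \<open>The double sum supplies the coefficients from t^2 on for \<open>reg1\<close> and from t
  on for \<open>reg2\<close>. The lower ones involve \<open>E_1\<close> and \<open>E_2\<close>,
  which lack convergent series, and are precisely the terms subtracted beforehand.\<close>

lemma reg_expansion: "reg1 u has_fps_expansion gen u" "reg2 u has_fps_expansion fps_deriv (gen u)"
proof -
  obtain \<rho> where \<rho>: "\<rho> > 0" "\<And>v. u + lat v \<noteq> 0 \<Longrightarrow> \<rho> \<le> cmod (u + lat v)" using lat_gap by blast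
  have ev: "\<forall>\<^sub>F t in nhds 0. 2 * cmod t \<le> \<rho>"
  proof -
    have "\<forall>\<^sub>F t in nhds (0::complex). t \<in> ball 0 (\<rho> / 2)"
      by (rule eventually_nhds_in_open) (use \<rho> in auto)
    then show ?thesis by eventually_elim (use \<rho> in \<open>auto\<close>)
  qed
  have 1: "(\<lambda>n. hecke_value (n + 1) u * t ^ n) sums reg1 u t" if t: "2 * cmod t \<le> \<rho>" for t
  proof -
    have "(\<lambda>n. 1 * (t ^ (n + 2) * hecke_value (n + 3) u)) sums
       ((hecke_value 1 (u - t) - hecke_value 1 u - t * hecke_value 2 u - cnj t * kappa)
         - in_Lam u * (inverse (0 - t) - inverse 0 - t * inverse (0\<^sup>2)))"
    proof (rule lattice_double_sum[OF \<rho>(2) t, where g = "\<lambda>x. inverse (x - t) - inverse x - t * inverse (x\<^sup>2)"])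
      show "((\<lambda>n. 1 * (t ^ (n + 2) * (u + lat v) powi (- int (n + 3)))) has_sum
         inverse (u + lat v - t) - inverse (u + lat v) - t * inverse ((u + lat v)\<^sup>2)) UNIV" if "u + lat v \<noteq> 0" for v
        using kernel_expansion(1)[of t "u + lat v"] \<rho>(2)[OF that] t that by simp
      show "((\<lambda>v. inverse (u + lat v - t) - inverse (u + lat v) - t * inverse ((u + lat v)\<^sup>2)) has_sum
         hecke_value 1 (u - t) - hecke_value 1 u - t * hecke_value 2 u - cnj t * kappa) UNIV"
        using hecke_value_1_shift[of u "- t"] by (simp add: algebra_simps)
    qed auto
    then have "(\<lambda>n. hecke_value (n + 2 + 1) u * t ^ (n + 2)) sums
       (reg1 u t - (\<Sum>n<2. hecke_value (n + 1) u * t ^ n))"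
      by (simp add: reg1_def algebra_simps eval_nat_numeral divide_inverse)
    then show ?thesis by (subst (asm) sums_iff_shift) (simp only: diff_add_cancel)
  qed
  show "reg1 u has_fps_expansion gen u"
    by (rule has_fps_expansionI, rule eventually_mono[OF ev]) (use 1 in \<open>simp add: gen_def\<close>)
  have 2: "(\<lambda>n. of_nat (n + 1) * hecke_value (n + 2) u * t ^ n) sums reg2 u t" if t: "2 * cmod t \<le> \<rho>" for t
  \<comment> \<open>The double sum yields t times the wanted expansion, so t = 0 is settled before
    dividing.\<close>
  proof (cases "t = 0")
    case True
    then show ?thesis using powser_sums_zero[of "\<lambda>n. of_nat (n + 1) * hecke_value (n + 2) u"] by (simp add: reg2_def numeral_2_eq_2)
  next
    case False
    have "(\<lambda>n. of_nat (n + 2) * (t ^ (n + 2) * hecke_value (n + 3) u)) sums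
       (t * (hecke_value 2 (u - t) - hecke_value 2 u) - in_Lam u * (t * (inverse ((0 - t)\<^sup>2) - inverse (0\<^sup>2))))"
    proof (rule lattice_double_sum[OF \<rho>(2) t, where g = "\<lambda>x. t * (inverse ((x - t)\<^sup>2) - inverse (x\<^sup>2))"])
      show "((\<lambda>n. of_nat (n + 2) * (t ^ (n + 2) * (u + lat v) powi (- int (n + 3)))) has_sum
         t * (inverse ((u + lat v - t)\<^sup>2) - inverse ((u + lat v)\<^sup>2))) UNIV" if "u + lat v \<noteq> 0" for v
        using kernel_expansion(2)[of t "u + lat v"] \<rho>(2)[OF that] t that by simp
      have "((\<lambda>v. t * ((u + - t + lat v) powi (- int 2) - (u + lat v) powi (- int 2))) has_sum
         t * (hecke_value 2 (u + - t) - hecke_value 2 u)) UNIV"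
        by (intro has_sum_cmult_right hecke_value_diff) simp
      then show "((\<lambda>v. t * (inverse ((u + lat v - t)\<^sup>2) - inverse ((u + lat v)\<^sup>2))) has_sum
         t * (hecke_value 2 (u - t) - hecke_value 2 u)) UNIV"
        by (simp add: power_int_minus algebra_simps)
      show "cmod (of_nat (n + 2)) \<le> real (n + 2)" for n
        by (simp only: norm_of_nat)
    qed
    from sums_mult[OF this, of "inverse t"]
    have "(\<lambda>n. inverse t * (of_nat (n + 2) * (t ^ (n + 2) * hecke_value (n + 3) u))) sums
       (inverse t * (t * (hecke_value 2 (u - t) - hecke_value 2 u) - in_Lam u * (t * (inverse ((0 - t)\<^sup>2) - inverse (0\<^sup>2)))))" .
    moreover have "inverse t * (of_nat (n + 2) * (t ^ (n + 2) * hecke_value (n + 3) u))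
        = of_nat (n + 1 + 1) * hecke_value (n + 1 + 2) u * t ^ (n + 1)" for n
    proof -
      have "n + 3 = n + 1 + 2" "n + 2 = n + 1 + 1" "t ^ (n + 2) = t * t ^ (n + 1)" by simp_all
      then show ?thesis using False by (simp only:) simp
    qed
    moreover have "inverse t * (t * (hecke_value 2 (u - t) - hecke_value 2 u) - in_Lam u * (t * (inverse ((0 - t)\<^sup>2) - inverse (0\<^sup>2))))
        = reg2 u t - (\<Sum>n<1. of_nat (n + 1) * hecke_value (n + 2) u * t ^ n)"
      using False by (simp add: reg2_def field_simps numeral_2_eq_2)
    ultimately have "(\<lambda>n. of_nat (n + 1 + 1) * hecke_value (n + 1 + 2) u * t ^ (n + 1)) sums
       (reg2 u t - (\<Sum>n<1. of_nat (n + 1) * hecke_value (n + 2) u * t ^ n))"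
      by (simp only:)
    then show ?thesis by (subst (asm) sums_iff_shift) (simp only: diff_add_cancel)
  qed
  show "reg2 u has_fps_expansion fps_deriv (gen u)"
    by (rule has_fps_expansionI, rule eventually_mono[OF ev]) (use 2 in \<open>simp add: gen_def\<close>)
qed

lemma reg_expansion_scaled:
  "(\<lambda>t. reg1 u (a * t)) has_fps_expansion Abs_fps (\<lambda>n. a ^ n * hecke_value (n + 1) u)"
  "(\<lambda>t. reg2 u (a * t)) has_fps_expansion Abs_fps (\<lambda>n. a ^ n * (of_nat (n + 1) * hecke_value (n + 2) u))"
proof -
  have g: "(\<lambda>t. a * t) has_fps_expansion (fps_const a * fps_X)"
    by (intro fps_expansion_intros)
  have "fps_nth (fps_const a * fps_X) 0 = 0" by simp
  note * = has_fps_expansion_compose[OF _ g this]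
  show "(\<lambda>t. reg1 u (a * t)) has_fps_expansion Abs_fps (\<lambda>n. a ^ n * hecke_value (n + 1) u)"
    using *[OF reg_expansion(1)[of u]] by (simp add: o_def fps_compose_linear gen_def)
  show "(\<lambda>t. reg2 u (a * t)) has_fps_expansion Abs_fps (\<lambda>n. a ^ n * (of_nat (n + 1) * hecke_value (n + 2) u))"
    using *[OF reg_expansion(2)[of u]] by (simp add: o_def fps_compose_linear gen_def)
qed

section \<open>The addition theorem\<close>

lemma Lam_fundamental_domain:
  obtains K where "compact K" "\<And>u. \<exists>\<omega>\<in>Lam. u + \<omega> \<in> K"
proof
  define K where "K = (\<lambda>p. of_real (fst p) * z + of_real (snd p)) ` ({0..1} \<times> {0..1::real})"
  show "compact K" unfolding K_def
    by (intro compact_continuous_image compact_Times continuous_intros compact_Icc)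
  fix u :: complex
  define \<alpha> where "\<alpha> = Im u / Im z"
  define \<beta> where "\<beta> = Re u - \<alpha> * Re z"
  have u: "u = of_real \<alpha> * z + of_real \<beta>"
    using Im_pos by (simp add: complex_eq_iff \<alpha>_def \<beta>_def)
  define \<omega> where "\<omega> = lat (- \<lfloor>\<alpha>\<rfloor>, - \<lfloor>\<beta>\<rfloor>)"
  have "u + \<omega> = of_real (frac \<alpha>) * z + of_real (frac \<beta>)"
    by (subst u) (simp add: \<omega>_def lat_def frac_def algebra_simps)
  moreover have "frac \<alpha> \<in> {0..1}" "frac \<beta> \<in> {0..1}"
    using frac_lt_1[of \<alpha>] frac_lt_1[of \<beta>] by (auto intro: less_imp_le)
  ultimately have "u + \<omega> \<in> K" unfolding K_def by force
  then show "\<exists>\<omega>\<in>Lam. u + \<omega> \<in> K" by (auto simp: \<omega>_def Lam_def)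
qed

text \<open>With \<open>v\<close> fixed, the difference of the two sides is elliptic in \<open>u\<close>. Its expansion at the only
  possible poles \<open>0\<close> and \<open>-v\<close> shows that it extends to an entire function vanishing there.\<close>

lemma hecke_value_addition:
  assumes v: "v \<notin> Lam" and u: "u \<notin> Lam" and uv: "u + v \<notin> Lam"
  shows "(hecke_value 1 u + hecke_value 1 v - hecke_value 1 (u + v))\<^sup>2
    = hecke_value 2 u + hecke_value 2 v + hecke_value 2 (u + v) - 3 * hecke_value 2 0"
proof -
  define H where "H u = (hecke_value 1 u + hecke_value 1 v - hecke_value 1 (u + v))\<^sup>2
    - hecke_value 2 u - hecke_value 2 v - hecke_value 2 (u + v) + 3 * hecke_value 2 0" for u
  \<comment> \<open>The value 0 at the possible poles is the limit of \<open>H\<close> there; the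
    case t = 0 below checks this.\<close>
  define f where "f u = (if u \<in> Lam \<or> u + v \<in> Lam then 0 else H u)" for u
  have f_expansion: "\<exists>F. (\<lambda>t. f (p - t)) has_fps_expansion F" for p
  proof -
    \<comment> \<open>The coefficient of 1/t in \<open>E_1(p - t) + E_1(v) - E_1(p + v - t)\<close>.
      Since v is not in \<Lambda>, at most one of p and p + v is a pole, so \<epsilon>^2 matches the
      double poles of the \<open>E_2\<close> terms.\<close>
    define \<epsilon> where "\<epsilon> = in_Lam (p + v) - in_Lam p"
    have not_both: "p \<notin> Lam \<or> p + v \<notin> Lam"
      using v Lam_closed(3)[of "p + v" p] by auto
    have \<epsilon>2: "\<epsilon>\<^sup>2 = in_Lam p + in_Lam (p + v)"
      using not_both by (auto simp: \<epsilon>_def in_Lam_def)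
    define D where "D t = reg1 p t + hecke_value 1 v - reg1 (p + v) t" for t
    define FD where "FD = gen p + fps_const (hecke_value 1 v) - gen (p + v)"
    have D: "D has_fps_expansion FD"
      unfolding D_def[abs_def] FD_def by (intro fps_expansion_intros reg_expansion)
    have FD0: "fps_nth FD 0 = hecke_value 1 p + hecke_value 1 v - hecke_value 1 (p + v)"
      by (simp add: FD_def gen_def)
    have FD1: "fps_nth FD 1 = hecke_value 2 p - hecke_value 2 (p + v)"
      by (simp add: FD_def gen_def numeral_2_eq_2)
    have per0: "hecke_value l p = hecke_value l 0" "hecke_value l (p + v) = hecke_value l v" if "p \<in> Lam" "l \<ge> 1" for l
      using hecke_value_periodic[OF that(2,1), of 0] hecke_value_periodic[OF that(2,1), of v] by (simp_all add: add.commute)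
    have per1: "hecke_value l (p + v) = hecke_value l 0" "hecke_value l p = (-1) ^ l * hecke_value l v" if "p + v \<in> Lam" "l \<ge> 1" for l
      using hecke_value_periodic[OF that(2,1), of 0] hecke_value_periodic[OF that(2,1), of "- v"] hecke_value_minus[OF that(2), of v]
      by simp_all
    have E10: "hecke_value 1 0 = 0" by (rule hecke_value_1_Lam[OF Lam_closed(1)])
    \<comment> \<open>At a pole the constant term of \<open>D\<close> vanishes, since
      \<open>E_1(0) = 0\<close> and \<open>E_1\<close> is odd and periodic. Hence the cross term 2
      \<epsilon> D(t) / t has no pole either.\<close>
    have \<epsilon>0: "\<epsilon> \<noteq> 0 \<Longrightarrow> fps_nth FD 0 = 0"
    proof -
      assume "\<epsilon> \<noteq> 0"
      then consider "p \<in> Lam" | "p + v \<in> Lam" by (auto simp: \<epsilon>_def in_Lam_def split: if_splits)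
      then show ?thesis
      proof cases
        case 1
        then show ?thesis using per0[OF 1, of 1] E10 by (simp add: FD0)
      next
        case 2
        then show ?thesis using per1[OF 2, of 1] E10 by (simp add: FD0)
      qed
    qed
    \<comment> \<open>The quotient D(t) / t with its singularity removed, in the form expected by
      \<open>has_fps_expansion_shift\<close>.\<close>
    define Q where "Q t = (if t = 0 then fps_nth FD 1 else (D t - fps_nth FD 0) / t ^ 1)" for t
    have Q: "Q has_fps_expansion fps_shift 1 (FD - fps_const (fps_nth FD 0))"
    proof -
      have "1 \<le> subdegree (FD - fps_const (fps_nth FD 0)) \<or> FD - fps_const (fps_nth FD 0) = 0"
        by (metis fps_nth_fps_const fps_sub_nth diff_self less_one linorder_not_less nth_subdegree_nonzero)
      then show ?thesis
      proof
        assume "1 \<le> subdegree (FD - fps_const (fps_nth FD 0))"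
        then show ?thesis unfolding Q_def[abs_def]
          by (intro has_fps_expansion_shift fps_expansion_intros D) auto
      next
        assume 0: "FD - fps_const (fps_nth FD 0) = 0"
        have "(\<lambda>t. D t - fps_nth FD 0) has_fps_expansion 0"
          unfolding 0[symmetric] by (intro fps_expansion_intros D)
        then have "\<forall>\<^sub>F t in nhds 0. D t - fps_nth FD 0 = 0" by (simp add: has_fps_expansion_0_iff)
        moreover have "fps_nth FD 1 = 0" using 0 by (metis fps_nth_fps_const fps_sub_nth diff_zero fps_zero_nth one_neq_zero)
        ultimately have "\<forall>\<^sub>F t in nhds 0. Q t = 0" by (auto simp: Q_def elim!: eventually_mono)
        then show ?thesis unfolding 0 by (simp add: has_fps_expansion_0_iff)
      qed
    qed
    define R where "R t = (D t)\<^sup>2 + 2 * \<epsilon> * Q t - reg2 p t - reg2 (p + v) t - hecke_value 2 v + 3 * hecke_value 2 0" for t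
    have R: "R has_fps_expansion FD\<^sup>2 + fps_const (2 * \<epsilon>) * fps_shift 1 (FD - fps_const (fps_nth FD 0))
       - fps_deriv (gen p) - fps_deriv (gen (p + v)) - fps_const (hecke_value 2 v) + fps_const (3 * hecke_value 2 0)"
      unfolding R_def[abs_def] by (intro fps_expansion_intros D Q reg_expansion)
    obtain e1 where e1: "e1 > 0" "\<And>t. cmod t < e1 \<Longrightarrow> t \<noteq> 0 \<Longrightarrow> p - t \<notin> Lam" using eventually_notin_Lam by metis
    obtain e2 where e2: "e2 > 0" "\<And>t. cmod t < e2 \<Longrightarrow> t \<noteq> 0 \<Longrightarrow> p + v - t \<notin> Lam" using eventually_notin_Lam by metis
    have eq: "f (p - t) = R t" if t: "cmod t < min e1 e2" for t
    proof (cases "t = 0")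
      case False
      have "p - t \<notin> Lam" "p - t + v \<notin> Lam" using e1 e2 t False by (auto simp: algebra_simps)
      then have "f (p - t) = H (p - t)" by (simp add: f_def)
      also have "hecke_value 1 (p - t) + hecke_value 1 v - hecke_value 1 (p - t + v) = D t + \<epsilon> / t"
        using False by (simp add: D_def reg1_def \<epsilon>_def algebra_simps diff_divide_distrib)
      then have "H (p - t) = (D t + \<epsilon> / t)\<^sup>2 - (reg2 p t + in_Lam p / t\<^sup>2) - hecke_value 2 v
          - (reg2 (p + v) t + in_Lam (p + v) / t\<^sup>2) + 3 * hecke_value 2 0"
        unfolding H_def by (simp add: reg2_def algebra_simps)
      also have "(D t + \<epsilon> / t)\<^sup>2 = (D t)\<^sup>2 + 2 * (\<epsilon> * (D t / t)) + (in_Lam p + in_Lam (p + v)) / t\<^sup>2"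
        unfolding \<epsilon>2[symmetric] by (simp add: power2_sum power_divide)
      also have "\<epsilon> * (D t / t) = \<epsilon> * Q t"
        using \<epsilon>0 False by (cases "\<epsilon> = 0") (auto simp: Q_def)
      finally show ?thesis by (simp add: R_def algebra_simps add_divide_distrib)
    next
      \<comment> \<open>If p or p + v is in \<Lambda>, then \<open>R 0\<close> must be 0.
        Periodicity and parity reduce it to multiples of \<open>E_2(0)\<close> and
        \<open>E_2(v)\<close>, which cancel; this is what fixes the constant 3
        \<open>E_2(0)\<close>.\<close>
      case True
      have D0: "D 0 = fps_nth FD 0"
        using has_fps_expansion_imp_0_eq_fps_nth_0[OF D] by simp
      have r2: "reg2 w 0 = hecke_value 2 w" for w by (simp add: reg2_def)
      consider "p \<in> Lam" | "p + v \<in> Lam" | "p \<notin> Lam" "p + v \<notin> Lam" by blast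
      then show ?thesis
      proof cases
        case 1
        then have "\<epsilon> = -1" using not_both by (simp add: \<epsilon>_def in_Lam_def)
        then show ?thesis using True 1 \<epsilon>0 per0[OF 1, of 2]
          by (simp add: f_def R_def D0 Q_def FD1[simplified] r2)
      next
        case 2
        then have "\<epsilon> = 1" using not_both by (simp add: \<epsilon>_def in_Lam_def)
        then show ?thesis using True 2 \<epsilon>0 per1[OF 2, of 2]
          by (simp add: f_def R_def D0 Q_def FD1[simplified] r2)
      next
        case 3
        then have "\<epsilon> = 0" by (simp add: \<epsilon>_def in_Lam_def)
        then show ?thesis using True 3 by (simp add: f_def R_def D0 FD0 r2 H_def)
      qed
    qed
    have "\<forall>\<^sub>F t in nhds (0::complex). t \<in> ball 0 (min e1 e2)"
      by (rule eventually_nhds_in_open) (use e1 e2 in auto)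
    then have "\<forall>\<^sub>F t in nhds 0. R t = f (p - t)" by eventually_elim (use eq in auto)
    then have "(\<lambda>t. f (p - t)) has_fps_expansion (FD\<^sup>2 + fps_const (2 * \<epsilon>) * fps_shift 1 (FD - fps_const (fps_nth FD 0))
       - fps_deriv (gen p) - fps_deriv (gen (p + v)) - fps_const (hecke_value 2 v) + fps_const (3 * hecke_value 2 0))"
      using R by (subst (asm) has_fps_expansion_cong) auto
    then show ?thesis by blast
  qed
  have an: "f analytic_on {p}" for p
  proof -
    obtain F where F: "(\<lambda>t. f (p - t)) has_fps_expansion F" using f_expansion by blast
    have "(\<lambda>t. - t) has_fps_expansion (- fps_X :: complex fps)" by (intro fps_expansion_intros)
    from has_fps_expansion_compose[OF F this] have "(\<lambda>t. f (p + t)) has_fps_expansion (F oo - fps_X)"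
      by (simp add: o_def)
    then show ?thesis by (rule has_fps_expansion_imp_analytic)
  qed
  have hol: "f holomorphic_on UNIV"
    using an by (meson analytic_imp_holomorphic analytic_on_analytic_at iso_tuple_UNIV_I)
  have per: "f (x + \<omega>) = f x" if "\<omega> \<in> Lam" for x \<omega>
  proof -
    have a: "x + \<omega> \<in> Lam \<longleftrightarrow> x \<in> Lam" for x
      using Lam_closed(2)[of x \<omega>] Lam_closed(3)[of "x + \<omega>" \<omega>] that by auto
    have b: "x + \<omega> + v = (x + v) + \<omega>" by simp
    have "hecke_value l (x + \<omega>) = hecke_value l x" "hecke_value l (x + \<omega> + v) = hecke_value l (x + v)" if "l \<ge> 1" for l
      unfolding b using hecke_value_periodic[OF that \<open>\<omega> \<in> Lam\<close>] by auto
    then show ?thesis unfolding f_def H_def using a[of x] a[of "x + v"] by (simp add: b)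
  qed
  obtain K where K: "compact K" "\<And>u. \<exists>\<omega>\<in>Lam. u + \<omega> \<in> K" using Lam_fundamental_domain by blast
  have "range f \<subseteq> f ` K"
  proof safe
    fix x
    obtain \<omega> where "\<omega> \<in> Lam" "x + \<omega> \<in> K" using K by blast
    then show "f x \<in> f ` K" using per[of \<omega> x] by (metis imageI)
  qed
  moreover have "bounded (f ` K)"
    using K(1) hol by (intro compact_imp_bounded compact_continuous_image)
      (auto intro: continuous_on_subset holomorphic_on_imp_continuous_on)
  ultimately have "bounded (range f)" using bounded_subset by blast
  with hol have "f constant_on UNIV" by (rule Liouville_theorem)
  then have "f u = f 0" by (auto simp: constant_on_def)
  moreover have "f 0 = 0" by (simp add: f_def Lam_closed)
  ultimately have "H u = 0" using u uv by (simp add: f_def)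
  then show ?thesis by (simp add: H_def algebra_simps)
qed

lemma hecke_value_addition_sym:
  assumes "u \<notin> Lam" "v \<notin> Lam" "w \<notin> Lam" and uvw: "u + v + w \<in> Lam"
  shows "(hecke_value 1 u + hecke_value 1 v + hecke_value 1 w)\<^sup>2
    = hecke_value 2 u + hecke_value 2 v + hecke_value 2 w - 3 * hecke_value 2 0"
proof -
  have "u + v \<notin> Lam"
    using Lam_closed(3)[OF uvw, of "u + v"] assms(3) by auto
  note * = hecke_value_addition[OF assms(2,1) this]
  have "hecke_value l w = (-1) ^ l * hecke_value l (u + v)" if "l \<ge> 1" for l
    using hecke_value_periodic[OF that uvw, of "- (u + v)"] hecke_value_minus[OF that, of "u + v"]
    by (simp add: algebra_simps)
  from this[of 1] this[of 2] * show ?thesis by simp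
qed

section \<open>Comparison of coefficients in t\<close>

definition hecke_triple :: "complex \<Rightarrow> complex \<Rightarrow> complex \<Rightarrow> complex \<Rightarrow> complex \<Rightarrow> complex \<Rightarrow> nat \<Rightarrow> complex"
  where "hecke_triple a b c u v w l =
    a ^ (l - 1) * hecke_value l u + b ^ (l - 1) * hecke_value l v + c ^ (l - 1) * hecke_value l w"

lemma eventually_notin_Lam_scaled:
  assumes "u \<in> Lam \<Longrightarrow> a \<noteq> 0"
  shows "\<forall>\<^sub>F t in nhds 0. t \<noteq> 0 \<longrightarrow> u - a * t \<notin> Lam"
proof (cases "a = 0")
  case False
  obtain e where e: "e > 0" "\<And>t. cmod t < e \<Longrightarrow> t \<noteq> 0 \<Longrightarrow> u - t \<notin> Lam"
    using eventually_notin_Lam by metis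
  have "\<forall>\<^sub>F t in nhds (0::complex). t \<in> ball 0 (e / cmod a)"
    by (rule eventually_nhds_in_open) (use e False in auto)
  then show ?thesis
  proof eventually_elim
    case (elim t)
    then have "cmod (a * t) < e" using False by (simp add: norm_mult field_simps)
    then show ?case using e(2)[of "a * t"] False by auto
  qed
qed (use assms in auto)

text \<open>Stated with \<open>p + p\<close> so that, for a constant power series p, the middle
  coefficient is again a constant series.\<close>

lemma square_mult_diff:
  fixes x y p :: "'r::comm_ring_1"
  shows "(x * y - p)\<^sup>2 = x\<^sup>2 * y\<^sup>2 - (p + p) * (x * y) + p\<^sup>2"
  by (simp add: power2_eq_square algebra_simps)

lemma sum_pairs_eq_fps_nth:
  fixes g :: "nat \<Rightarrow> complex"
  assumes "k \<ge> 2"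
  shows "(\<Sum>(l, m) \<in> {(l, m). l + m = k \<and> 1 \<le> l \<and> 1 \<le> m}. g l * g m)
     = fps_nth ((Abs_fps (\<lambda>n. g (n + 1)))\<^sup>2) (k - 2)"
proof -
  have "(\<Sum>(l, m) \<in> {(l, m). l + m = k \<and> 1 \<le> l \<and> 1 \<le> m}. g l * g m)
     = (\<Sum>i\<in>{0..k-2}. g (i + 1) * g (k - 2 - i + 1))"
    by (rule sum.reindex_bij_witness[of _ "\<lambda>i. (i + 1, k - 2 - i + 1)" "\<lambda>p. fst p - 1"])
       (use assms in auto)
  then show ?thesis by (simp add: power2_eq_square fps_mult_nth)
qed

text \<open>Here q/t and r/t^2 collect the poles, so the addition theorem reads (T - q/t)^2 = S +
  r/t^2 - e, or (t T - q)^2 = t^2 (S - e) + r. In the coefficient of t^k the convolution comes from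
  T^2, the term with q from the cross product, and r is absent because k > 0.\<close>

lemma hecke_triple_convolution:
  assumes uvw: "u + v + w \<in> Lam" and abc: "a + b + c = 0"
    and nz: "u \<in> Lam \<Longrightarrow> a \<noteq> 0" "v \<in> Lam \<Longrightarrow> b \<noteq> 0" "w \<in> Lam \<Longrightarrow> c \<noteq> 0"
    and k: "k \<ge> 2"
  shows "(\<Sum>(l, m) \<in> {(l, m). l + m = k \<and> 1 \<le> l \<and> 1 \<le> m}. hecke_triple a b c u v w l * hecke_triple a b c u v w m)
    = 2 * (in_Lam u / a + in_Lam v / b + in_Lam w / c) * hecke_triple a b c u v w k
      + of_nat (k - 1) * (a ^ (k - 2) * hecke_value k u + b ^ (k - 2) * hecke_value k v + c ^ (k - 2) * hecke_value k w)
      - (if k = 2 then 3 * hecke_value 2 0 else 0)"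
proof -
  define q where "q = in_Lam u / a + in_Lam v / b + in_Lam w / c"
  define r where "r = in_Lam u / a\<^sup>2 + in_Lam v / b\<^sup>2 + in_Lam w / c\<^sup>2"
  define T where "T t = reg1 u (a * t) + reg1 v (b * t) + reg1 w (c * t)" for t
  define S where "S t = reg2 u (a * t) + reg2 v (b * t) + reg2 w (c * t)" for t
  define FT where "FT = Abs_fps (\<lambda>n. hecke_triple a b c u v w (n + 1))"
  define FS where "FS = Abs_fps (\<lambda>n. of_nat (n + 1) *
     (a ^ n * hecke_value (n + 2) u + b ^ n * hecke_value (n + 2) v + c ^ n * hecke_value (n + 2) w))"
  define e where "e = 3 * hecke_value 2 0"
  have T: "T has_fps_expansion FT"
  proof -
    have "T has_fps_expansion (Abs_fps (\<lambda>n. a ^ n * hecke_value (n + 1) u)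
      + Abs_fps (\<lambda>n. b ^ n * hecke_value (n + 1) v) + Abs_fps (\<lambda>n. c ^ n * hecke_value (n + 1) w))"
      unfolding T_def[abs_def] by (intro fps_expansion_intros reg_expansion_scaled)
    also have "\<dots> = FT" by (simp add: fps_eq_iff FT_def hecke_triple_def)
    finally show ?thesis .
  qed
  have S: "S has_fps_expansion FS"
  proof -
    have "S has_fps_expansion (Abs_fps (\<lambda>n. a ^ n * (of_nat (n + 1) * hecke_value (n + 2) u))
      + Abs_fps (\<lambda>n. b ^ n * (of_nat (n + 1) * hecke_value (n + 2) v))
      + Abs_fps (\<lambda>n. c ^ n * (of_nat (n + 1) * hecke_value (n + 2) w)))"
      unfolding S_def[abs_def] by (intro fps_expansion_intros reg_expansion_scaled)
    also have "\<dots> = FS" by (simp add: fps_eq_iff FS_def algebra_simps)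
    finally show ?thesis .
  qed
  have ev: "\<forall>\<^sub>F t in nhds 0. t \<noteq> 0 \<longrightarrow> u - a * t \<notin> Lam" "\<forall>\<^sub>F t in nhds 0. t \<noteq> 0 \<longrightarrow> v - b * t \<notin> Lam"
    "\<forall>\<^sub>F t in nhds 0. t \<noteq> 0 \<longrightarrow> w - c * t \<notin> Lam"
    using nz by (simp_all add: eventually_notin_Lam_scaled)
  \<comment> \<open>The extra factor t makes the equation trivial at t = 0, as an expansion on a
    full neighbourhood demands; it is cancelled later as \<open>fps_X\<close>.\<close>
  have "\<forall>\<^sub>F t in nhds 0. t * (t * T t - q)\<^sup>2 = t * (t\<^sup>2 * (S t - e) + r)"
    using ev
  proof eventually_elim
    case (elim t)
    show ?case
    proof (cases "t = 0")
      case False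
      have cn: "cnj (a * t) + cnj (b * t) + cnj (c * t) = 0"
        using abc by (metis complex_cnj_add complex_cnj_zero distrib_right mult_zero_left)
      have "(u - a * t) + (v - b * t) + (w - c * t) = u + v + w - (a + b + c) * t" by (simp add: algebra_simps)
      also have "\<dots> \<in> Lam" using uvw abc by simp
      finally have "(hecke_value 1 (u - a * t) + hecke_value 1 (v - b * t) + hecke_value 1 (w - c * t))\<^sup>2
        = hecke_value 2 (u - a * t) + hecke_value 2 (v - b * t) + hecke_value 2 (w - c * t) - 3 * hecke_value 2 0"
        using elim False by (intro hecke_value_addition_sym) auto
      moreover have "hecke_value 1 (u - a * t) + hecke_value 1 (v - b * t) + hecke_value 1 (w - c * t) = T t - q / t"
      proof -
        have "T t = hecke_value 1 (u - a * t) + hecke_value 1 (v - b * t) + hecke_value 1 (w - c * t)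
           - (cnj (a * t) + cnj (b * t) + cnj (c * t)) * kappa + (in_Lam u / (a * t) + in_Lam v / (b * t) + in_Lam w / (c * t))"
          unfolding T_def reg1_def by (simp only: algebra_simps)
        then show ?thesis unfolding cn by (simp add: q_def add_divide_distrib)
      qed
      moreover have "hecke_value 2 (u - a * t) + hecke_value 2 (v - b * t) + hecke_value 2 (w - c * t) = S t + r / t\<^sup>2"
        by (simp add: S_def reg2_def r_def add_divide_distrib power_mult_distrib)
      ultimately have *: "(T t - q / t)\<^sup>2 = S t + r / t\<^sup>2 - e" by (simp add: e_def)
      have "(t * T t - q)\<^sup>2 = t\<^sup>2 * (T t - q / t)\<^sup>2"
        using False by (simp add: power_mult_distrib[symmetric] right_diff_distrib)
      also have "\<dots> = t\<^sup>2 * (S t - e) + r" unfolding * using False by (simp add: algebra_simps)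
      finally show ?thesis by simp
    qed simp
  qed
  moreover have "(\<lambda>t. t * (t * T t - q)\<^sup>2) has_fps_expansion fps_X * (fps_X * FT - fps_const q)\<^sup>2"
    by (intro fps_expansion_intros T)
  ultimately have "(\<lambda>t. t * (t\<^sup>2 * (S t - e) + r)) has_fps_expansion fps_X * (fps_X * FT - fps_const q)\<^sup>2"
    by (subst (asm) has_fps_expansion_cong) auto
  moreover have "(\<lambda>t. t * (t\<^sup>2 * (S t - e) + r)) has_fps_expansion fps_X * (fps_X\<^sup>2 * (FS - fps_const e) + fps_const r)"
    by (intro fps_expansion_intros S)
  ultimately have "fps_X * (fps_X * FT - fps_const q)\<^sup>2 = fps_X * (fps_X\<^sup>2 * (FS - fps_const e) + fps_const r)"
    using fps_expansion_unique_complex by blast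
  then have "(fps_X * FT - fps_const q)\<^sup>2 = fps_X\<^sup>2 * (FS - fps_const e) + fps_const r" by simp
  moreover have "(fps_X * FT - fps_const q)\<^sup>2 = fps_X\<^sup>2 * FT\<^sup>2 - fps_const (2 * q) * (fps_X * FT) + fps_const (q\<^sup>2)"
  proof -
    note 1 = square_mult_diff[of fps_X FT "fps_const q"]
    have 2: "fps_const q + fps_const q = fps_const (2 * q)" by (simp only: fps_const_add mult_2)
    have 3: "(fps_const q)\<^sup>2 = fps_const (q\<^sup>2)" by (simp only: fps_const_mult power2_eq_square)
    show ?thesis unfolding 1 2 3 ..
  qed
  ultimately have "fps_nth (fps_X\<^sup>2 * FT\<^sup>2 - fps_const (2 * q) * (fps_X * FT) + fps_const (q\<^sup>2)) k
      = fps_nth (fps_X\<^sup>2 * (FS - fps_const e) + fps_const r) k" by simp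
  then have "fps_nth (FT\<^sup>2) (k - 2) = 2 * q * fps_nth FT (k - 1) + fps_nth FS (k - 2) - (if k = 2 then e else 0)"
    using k by (simp add: fps_X_power_mult_nth diff_eq_eq add.commute del: fps_const_mult split: if_splits)
  moreover have "k - 2 + 2 = k" "k - 2 + 1 = k - 1" "k - 1 + 1 = k" using k by auto
  ultimately show ?thesis
    unfolding sum_pairs_eq_fps_nth[OF k] FT_def FS_def e_def q_def by (simp only: fps_nth_Abs_fps)
qed

text \<open>Modulo \<Lambda> the point w is -v, and c = -b, so the last two summands have signs
  (-1)^l and (-1)^(l-1) relative to each other and cancel. For l = 1 the first summand has the
  factor 0^0 = 1, but \<open>E_1\<close> vanishes on \<Lambda>.\<close>

lemma hecke_triple_degenerate:
  assumes "u + v + w \<in> Lam" "u \<in> Lam" "b + c = 0" "l \<ge> 1"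
  shows "hecke_triple 0 b c u v w l = 0"
proof -
  have c: "c = - b" using assms(3) by (simp add: add_eq_0_iff)
  have "v + w \<in> Lam" using Lam_closed(3)[OF assms(1,2)] by simp
  from hecke_value_periodic[OF assms(4) this, of "- v"] hecke_value_minus[OF assms(4), of v]
  have w: "hecke_value l w = (-1) ^ l * hecke_value l v" by simp
  have u: "0 ^ (l - 1) * hecke_value l u = 0"
    using hecke_value_1_Lam[OF assms(2)] assms(4) by (cases "l = 1") auto
  have "c ^ j * (-1) ^ Suc j = - (b ^ j)" for j
  proof -
    have "c ^ j * (-1) ^ Suc j = - ((-1) ^ j * (-1) ^ j * b ^ j)"
      unfolding c power_minus[of b] power_Suc by (simp only: mult_ac mult_minus_left mult_minus_right mult_1_left)
    also have "(-1::complex) ^ j * (-1) ^ j = 1" by (simp flip: power_mult_distrib)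
    finally show ?thesis by simp
  qed
  from this[of "l - 1"] have "c ^ (l - 1) * ((-1) ^ l * hecke_value l v) = - (b ^ (l - 1) * hecke_value l v)"
    using assms(4) by (simp flip: mult.assoc)
  then show ?thesis using u by (simp add: hecke_triple_def w)
qed

lemma hecke_triple_perm:
  "hecke_triple a b c u v w l = hecke_triple b a c v u w l" "hecke_triple a b c u v w l = hecke_triple c b a w v u l"
  by (simp_all add: hecke_triple_def)

lemma hecke_triple_degenerate':
  assumes "u + v + w \<in> Lam" "a + b + c = 0" "l \<ge> 1"
    and "u \<in> Lam \<and> a = 0 \<or> v \<in> Lam \<and> b = 0 \<or> w \<in> Lam \<and> c = 0"
  shows "hecke_triple a b c u v w l = 0"
  using assms(4)
proof (elim disjE)
  assume "u \<in> Lam \<and> a = 0"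
  then show ?thesis using hecke_triple_degenerate[of u v w b c l] assms by auto
next
  assume "v \<in> Lam \<and> b = 0"
  then show ?thesis using hecke_triple_degenerate[of v u w a c l] assms hecke_triple_perm(1)[of a b c u v w l]
    by (simp add: add_ac)
next
  assume "w \<in> Lam \<and> c = 0"
  then show ?thesis using hecke_triple_degenerate[of w v u b a l] assms hecke_triple_perm(2)[of a b c u v w l]
    by (simp add: add_ac)
qed

end

section \<open>Dependence on the point of the upper half-plane\<close>

definition lattice_point :: "rat \<times> rat \<Rightarrow> complex \<Rightarrow> complex"
  where "lattice_point lam z = of_rat (fst lam) * z + of_rat (snd lam)"

lemma lattice_point_add: "lattice_point (lam + mu) z = lattice_point lam z + lattice_point mu z"
  by (simp add: lattice_point_def of_rat_add algebra_simps)

lemma complex_of_rat_eq: "(of_rat r :: complex) = of_real (of_rat r)"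
  by (induct r) (simp add: of_rat_rat)

lemma (in upper_half_point) lattice_point_in_Lam_iff: "lattice_point lam z \<in> Lam \<longleftrightarrow> lam \<in> \<int> \<times> \<int>"
proof
  assume "lam \<in> \<int> \<times> \<int>"
  then obtain m n where "fst lam = of_int m" "snd lam = of_int n"
    by (auto elim!: Ints_cases)
  then have "lattice_point lam z = lat (m, n)" by (simp add: lattice_point_def lat_def)
  then show "lattice_point lam z \<in> Lam" by (simp add: Lam_def)
next
  assume "lattice_point lam z \<in> Lam"
  then obtain v where v: "lattice_point lam z = lat v" by (auto simp: Lam_def)
  define p where "p = real_of_rat (fst lam) - of_int (fst v)"
  define q where "q = real_of_rat (snd lam) - of_int (snd v)"
  have "of_real p * z + of_real q = 0"
    using v by (simp add: lattice_point_def lat_def p_def q_def complex_of_rat_eq algebra_simps)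
  then have "\<bar>p\<bar> + \<bar>q\<bar> \<le> 0" using norm_real_combination_ge[OF Im_pos, of p q] by simp
  then have "real_of_rat (fst lam) = real_of_rat (of_int (fst v))" "real_of_rat (snd lam) = real_of_rat (of_int (snd v))"
    by (simp_all add: p_def q_def)
  then have "fst lam = of_int (fst v)" "snd lam = of_int (snd v)"
    by (simp_all only: of_rat_eq_iff)
  then show "lam \<in> \<int> \<times> \<int>" by (simp add: mem_Times_iff)
qed

lemma holomorphic_real_combination_power_int:
  "(\<lambda>z. (of_real p * z + of_real q) powi n) holomorphic_on upper_half_plane"
proof (cases "p = 0 \<and> q = 0")
  case False
  have "of_real p * z + of_real q \<noteq> 0" if "z \<in> upper_half_plane" for z
    using norm_real_combination_ge[of z p q] that False by (auto simp: upper_half_plane_def)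
  then show ?thesis by (intro holomorphic_intros) auto
qed auto

lemma open_upper_half_plane: "open upper_half_plane"
  unfolding upper_half_plane_def by (rule open_halfspace_Im_gt)

text \<open>Compares the lattices of all t near s with the fixed lattice of \<i>, so that one
  convergent sum over the latter majorises the series for all these t.\<close>

lemma upper_half_plane_comparison:
  assumes "s \<in> upper_half_plane"
  obtains d K where "d > 0" "K \<ge> 1" "\<And>t. dist s t \<le> d \<Longrightarrow> cmod t \<le> K"
    "\<And>t p q. t \<in> upper_half_plane \<Longrightarrow> dist s t \<le> d \<Longrightarrow>
       cmod (of_real p * \<i> + of_real q) \<le> K * cmod (of_real p * t + of_real q)"
proof
  define d where "d = Im s / 2"
  show d: "d > 0" using assms by (simp add: d_def upper_half_plane_def)
  define K where "K = max (cmod s + d) (1 + (1 + (cmod s + d)) / d)"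
  show "K \<ge> 1" unfolding K_def using d by (simp add: le_max_iff_disj)
  show ct: "cmod t \<le> K" if "dist s t \<le> d" for t
    using norm_triangle_ineq4[of s "s - t"] that by (simp add: dist_norm K_def le_max_iff_disj)
  fix t :: complex and p q :: real
  assume t: "t \<in> upper_half_plane" "dist s t \<le> d"
  have c: "cmod t \<le> cmod s + d"
    using norm_triangle_ineq4[of s "s - t"] t by (simp add: dist_norm)
  have i: "Im t \<ge> d"
    using abs_Im_le_cmod[of "s - t"] t by (simp add: dist_norm d_def)
  have "cmod (of_real p * \<i> + of_real q) \<le> \<bar>p\<bar> + \<bar>q\<bar>"
    by (rule norm_triangle_le) (simp add: norm_mult)
  also have "\<dots> \<le> (1 + (1 + cmod t) / Im t) * cmod (of_real p * t + of_real q)"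
    by (rule norm_real_combination_ge) (use t in \<open>simp add: upper_half_plane_def\<close>)
  also have "\<dots> \<le> K * cmod (of_real p * t + of_real q)"
  proof (rule mult_right_mono)
    have "(1 + cmod t) / Im t \<le> (1 + (cmod s + d)) / d"
      using c i d by (intro frac_le) auto
    then show "1 + (1 + cmod t) / Im t \<le> K" by (simp add: K_def le_max_iff_disj)
  qed auto
  finally show "cmod (of_real p * \<i> + of_real q) \<le> K * cmod (of_real p * t + of_real q)" .
qed

interpretation ui: upper_half_point \<i>
  by unfold_locales simp

definition shifted_point :: "rat \<times> rat \<Rightarrow> int \<times> int \<Rightarrow> complex \<Rightarrow> complex"
  where "shifted_point lam v z = of_real (of_rat (fst lam) + of_int (fst v)) * z + of_real (of_rat (snd lam) + of_int (snd v))"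

lemma (in upper_half_point) shifted_point_eq: "shifted_point lam v z = lattice_point lam z + lat v"
  by (simp add: shifted_point_def lattice_point_def lat_def complex_of_rat_eq algebra_simps)

lemma eisenstein_holomorphic:
  assumes l: "l \<ge> 3"
  shows "eisenstein l lam holomorphic_on upper_half_plane"
proof -
  have "(\<lambda>z. \<Sum>\<^sub>\<infinity>v\<in>UNIV. shifted_point lam v z powi (- int l)) holomorphic_on upper_half_plane"
  proof (rule holomorphic_infsum(1)[OF open_upper_half_plane])
    show "(\<lambda>z. shifted_point lam v z powi (- int l)) holomorphic_on upper_half_plane" for v
      unfolding shifted_point_def by (rule holomorphic_real_combination_power_int)
    fix s assume "s \<in> upper_half_plane"
    then obtain d K where dK: "d > 0" "K \<ge> 1"
      "\<And>t p q. t \<in> upper_half_plane \<Longrightarrow> dist s t \<le> d \<Longrightarrow>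
         cmod (of_real p * \<i> + of_real q) \<le> K * cmod (of_real p * t + of_real q)"
      using upper_half_plane_comparison by metis
    define M where "M v = K ^ l * cmod (lattice_point lam \<i> + ui.lat v) powr (- real l)" for v
    have "M summable_on UNIV" unfolding M_def
      by (intro summable_on_cmult_right ui.summable_lat_powr) (use l in auto)
    moreover have "cmod (shifted_point lam v t powi (- int l)) \<le> M v"
      if t: "t \<in> upper_half_plane" "dist s t \<le> d" for v t
    proof (cases "shifted_point lam v t = 0")
      case False
      define x where "x = cmod (shifted_point lam v t)"
      define y where "y = cmod (lattice_point lam \<i> + ui.lat v)"
      have yx: "y \<le> K * x"
        using dK(3)[OF t] unfolding x_def y_def ui.shifted_point_eq[symmetric] unfolding shifted_point_def .
      have x: "x > 0" using False by (simp add: x_def)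
      \<comment> \<open>Vanishing at \<i> would force both real coefficients to be 0, hence
        vanishing at t as well.\<close>
      have "y > 0"
      proof (rule ccontr)
        assume "\<not> y > 0"
        then have "y = 0" by (simp add: y_def)
        then have 0: "ui.lat v + lattice_point lam \<i> = 0" by (simp add: y_def add.commute)
        then have "of_rat (fst lam) + of_int (fst v) = (0::real)" "of_rat (snd lam) + of_int (snd v) = (0::real)"
          using norm_real_combination_ge[of \<i> "of_rat (fst lam) + of_int (fst v)" "of_rat (snd lam) + of_int (snd v)"]
            ui.shifted_point_eq[of lam v] by (auto simp: shifted_point_def add.commute)
        then have "shifted_point lam v t = 0" unfolding shifted_point_def by (simp only:) simp
        with False show False by simp
      qed
      then have "inverse (x ^ l) \<le> K ^ l * inverse (y ^ l)"
        using power_mono[OF yx, of l] x by (simp add: field_simps power_mult_distrib)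
      then show ?thesis
        using \<open>y > 0\<close> by (simp add: M_def x_def y_def norm_power_int power_int_minus powr_minus powr_realpow norm_inverse norm_power)
    qed (use l dK in \<open>simp add: M_def power_int_0_left_if\<close>)
    ultimately show "\<exists>d>0. \<exists>M Y. finite Y \<and> M summable_on UNIV \<and>
        (\<forall>v\<in>UNIV - Y. \<forall>t\<in>upper_half_plane. dist s t \<le> d \<longrightarrow> cmod (shifted_point lam v t powi (- int l)) \<le> M v)"
      using dK(1) by (intro exI[of _ d] conjI exI[of _ M] exI[of _ "{}"]) auto
  qed
  moreover have "(\<Sum>\<^sub>\<infinity>v\<in>UNIV. shifted_point lam v z powi (- int l)) = eisenstein l lam z" if "z \<in> upper_half_plane" for z
  proof -
    interpret upper_half_point z by unfold_locales (use that in \<open>simp add: upper_half_plane_def\<close>)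
    show ?thesis
      using infsumI[OF hecke_value_series[OF l, of "lattice_point lam z"]] eisenstein_eq_hecke_value[of l lam] l
      by (simp add: shifted_point_eq lattice_point_def)
  qed
  ultimately show ?thesis by (subst holomorphic_cong[OF refl]) auto
qed

lemma inverse_square_diff_bound:
  fixes x w :: complex
  assumes "2 * cmod w \<le> cmod x" "x \<noteq> 0"
  shows "cmod (inverse ((w + x)\<^sup>2) - inverse (x\<^sup>2)) \<le> 10 * cmod w * inverse (cmod x ^ 3)"
proof -
  have h: "cmod x / 2 \<le> cmod (w + x)"
    using norm_diff_ineq[of x w] assms(1) by (simp add: add.commute)
  then have wx: "w + x \<noteq> 0" using assms by auto
  have "inverse ((w + x)\<^sup>2) - inverse (x\<^sup>2) = - (w * (2 * x + w)) * inverse ((w + x)\<^sup>2) * inverse (x\<^sup>2)"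
    using wx assms(2) by (simp add: field_simps) (simp add: power2_eq_square algebra_simps)
  then have "cmod (inverse ((w + x)\<^sup>2) - inverse (x\<^sup>2))
      = cmod w * cmod (2 * x + w) * inverse (cmod (w + x) ^ 2) * inverse (cmod x ^ 2)"
    by (simp add: norm_mult norm_inverse norm_power)
  \<comment> \<open>The constant 10 is 5/2 from |2 x + w| times 4 from |w + x| >= |x| / 2.\<close>
  also have "\<dots> \<le> cmod w * (5 / 2 * cmod x) * (4 * inverse (cmod x ^ 2)) * inverse (cmod x ^ 2)"
  proof (intro mult_mono)
    show "cmod (2 * x + w) \<le> 5 / 2 * cmod x"
      using norm_triangle_ineq[of "2 * x" w] assms(1) by (simp add: norm_mult)
    have "inverse (cmod (w + x) ^ 2) \<le> inverse ((cmod x / 2) ^ 2)"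
      using h assms(2) by (intro le_imp_inverse_le power_mono) auto
    then show "inverse (cmod (w + x) ^ 2) \<le> 4 * inverse (cmod x ^ 2)"
      by (simp add: power_divide field_simps)
  qed auto
  also have "\<dots> = 10 * cmod w * inverse (cmod x ^ 3)"
    using assms(2) by (simp add: field_simps eval_nat_numeral)
  finally show ?thesis .
qed

text \<open>The non-holomorphic part of \<open>E_2\<close> does not depend on \<open>lam\<close> and
  cancels in the difference, which is an absolutely convergent series with terms of order
  |x|^(-3).\<close>

lemma eisenstein_2_diff_holomorphic:
  "(\<lambda>z. eisenstein 2 lam z - eisenstein 2 (0, 0) z) holomorphic_on upper_half_plane"
proof -
  let ?f = "\<lambda>v z. shifted_point lam v z powi (- 2) - shifted_point (0, 0) v z powi (- 2)"
  have "(\<lambda>z. \<Sum>\<^sub>\<infinity>v\<in>UNIV. ?f v z) holomorphic_on upper_half_plane"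
  proof (rule holomorphic_infsum(1)[OF open_upper_half_plane])
    show "(\<lambda>z. ?f v z) holomorphic_on upper_half_plane" for v
      unfolding shifted_point_def by (intro holomorphic_on_diff holomorphic_real_combination_power_int)
    fix s assume "s \<in> upper_half_plane"
    then obtain d K where dK: "d > 0" "K \<ge> 1" "\<And>t. dist s t \<le> d \<Longrightarrow> cmod t \<le> K"
      "\<And>t p q. t \<in> upper_half_plane \<Longrightarrow> dist s t \<le> d \<Longrightarrow>
         cmod (of_real p * \<i> + of_real q) \<le> K * cmod (of_real p * t + of_real q)"
      using upper_half_plane_comparison by metis
    define W where "W = cmod (of_rat (fst lam)) * K + cmod (of_rat (snd lam))"
    have W: "W \<ge> 0" using dK by (simp add: W_def)
    \<comment> \<open>\<open>W\<close> bounds the shift w for all t near s. Outside \<open>Y\<close>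
      one has 2 W K < y <= K |x|, hence 2 |w| <= |x| as \<open>inverse_square_diff_bound\<close>
      requires.\<close>
    define Y where "Y = {v. cmod (0 + ui.lat v) \<le> 2 * W * K}"
    define M where "M v = 10 * W * K ^ 3 * cmod (0 + ui.lat v) powr (- 3)" for v
    have "M summable_on UNIV" unfolding M_def
      by (intro summable_on_cmult_right ui.summable_lat_powr) auto
    moreover have "finite Y" unfolding Y_def by (rule ui.finite_lat_ball)
    moreover have "cmod (?f v t) \<le> M v"
      if v: "v \<in> UNIV - Y" and t: "t \<in> upper_half_plane" "dist s t \<le> d" for v t
    proof -
      define y where "y = cmod (0 + ui.lat v)"
      define x where "x = shifted_point (0, 0) v t"
      define w where "w = lattice_point lam t"
      have f: "?f v t = inverse ((w + x)\<^sup>2) - inverse (x\<^sup>2)"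
        by (simp add: w_def x_def shifted_point_def lattice_point_def power_int_minus complex_of_rat_eq algebra_simps)
      have w: "cmod w \<le> W"
        unfolding w_def W_def lattice_point_def
        by (intro norm_triangle_le add_mono) (use dK(3)[OF t(2)] in \<open>auto simp: norm_mult intro!: mult_left_mono\<close>)
      have y: "y > 2 * W * K" using v by (auto simp: Y_def y_def)
      have yx: "y \<le> K * cmod x"
        using dK(4)[OF t, of "of_int (fst v)" "of_int (snd v)"]
        by (simp add: y_def x_def ui.lat_def shifted_point_def)
      have y0: "y > 0" using y W dK(2) by (smt (verit) mult_nonneg_nonneg)
      have "K * (2 * W) < K * cmod x" using y yx by (simp add: mult_ac)
      then have "2 * W < cmod x" using dK(2) by simp
      then have xw: "2 * cmod w \<le> cmod x" "x \<noteq> 0" using w W by auto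
      have i: "inverse (cmod x ^ 3) \<le> K ^ 3 * inverse (y ^ 3)"
        using power_mono[OF yx, of 3] y0 xw(2) by (simp add: field_simps power_mult_distrib)
      have "cmod (?f v t) \<le> 10 * cmod w * inverse (cmod x ^ 3)"
        unfolding f by (rule inverse_square_diff_bound[OF xw])
      also have "\<dots> \<le> 10 * W * (K ^ 3 * inverse (y ^ 3))"
        using w i W by (intro mult_mono) auto
      also have "\<dots> = M v" using y0 by (simp add: M_def y_def powr_minus)
      finally show ?thesis .
    qed
    ultimately show "\<exists>d>0. \<exists>M Y. finite Y \<and> M summable_on UNIV \<and>
        (\<forall>v\<in>UNIV - Y. \<forall>t\<in>upper_half_plane. dist s t \<le> d \<longrightarrow> cmod (?f v t) \<le> M v)"
      using dK(1) by blast
  qed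
  moreover have "(\<Sum>\<^sub>\<infinity>v\<in>UNIV. ?f v z) = eisenstein 2 lam z - eisenstein 2 (0, 0) z" if "z \<in> upper_half_plane" for z
  proof -
    interpret upper_half_point z by unfold_locales (use that in \<open>simp add: upper_half_plane_def\<close>)
    have e: "eisenstein 2 mu z = hecke_value 2 (lattice_point mu z)" for mu
      using eisenstein_eq_hecke_value[of 2 mu] by (simp add: lattice_point_def)
    have "lattice_point (0, 0) z = 0" by (simp add: lattice_point_def)
    then show ?thesis
      using infsumI[OF hecke_value_diff[of 2 0 "lattice_point lam z"]]
      by (simp add: shifted_point_eq e)
  qed
  ultimately show ?thesis by (subst holomorphic_cong[OF refl]) auto
qed

text \<open>The parameters \<open>lam\<close>, \<open>mu\<close>, \<open>nu\<close> and (0, 0) may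
  coincide, whereas \<open>eisenstein_space\<close> sums over a set; the coefficients of equal
  parameters are therefore added.\<close>

lemma eisenstein_spaceI:
  fixes f :: "complex \<Rightarrow> complex" and I :: "nat set"
  assumes "f holomorphic_on upper_half_plane" "finite I" "\<And>i. i \<in> I \<Longrightarrow> p i \<in> level_lattice N"
    and f: "\<And>z. z \<in> upper_half_plane \<Longrightarrow> f z = (\<Sum>i\<in>I. C i * eisenstein k (p i) z)"
  shows "f \<in> eisenstein_space k N"
proof -
  define coef where "coef lam = (\<Sum>i\<in>{i\<in>I. p i = lam}. C i)" for lam
  have "f z = (\<Sum>lam\<in>p ` I. coef lam * eisenstein k lam z)" if "z \<in> upper_half_plane" for z
  proof -
    have "f z = (\<Sum>lam\<in>p ` I. \<Sum>i\<in>{i\<in>I. p i = lam}. C i * eisenstein k (p i) z)"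
      unfolding f[OF that] by (rule sum.image_gen[OF assms(2)])
    also have "\<dots> = (\<Sum>lam\<in>p ` I. coef lam * eisenstein k lam z)"
      unfolding coef_def sum_distrib_right by (intro sum.cong) auto
    finally show ?thesis .
  qed
  then show ?thesis
    unfolding eisenstein_space_def using assms
    by (intro CollectI conjI exI[of _ "p ` I"] exI[of _ coef]) auto
qed

theorem theorem3p1:
  fixes N k w :: nat
    and lam mu nu :: "rat \<times> rat"
    and a b c :: complex
  assumes "N \<ge> 1" and "k \<ge> 2" and "w = k - 2"
    and "lam \<in> level_lattice N" and "mu \<in> level_lattice N" and "nu \<in> level_lattice N"
    and "lam + mu + nu \<in> \<int> \<times> \<int>"
    and "a + b + c = 0"
  shows "Phi k lam mu nu a b c holomorphic_on upper_half_plane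
    \<and> Phi k lam mu nu a b c \<in> eisenstein_space k N
    \<and> (lam \<notin> \<int> \<times> \<int> \<and> mu \<notin> \<int> \<times> \<int> \<and> nu \<notin> \<int> \<times> \<int> \<and> lam + mu + nu = (0, 0) \<longrightarrow>
        (w \<ge> 1 \<longrightarrow> (\<forall>z\<in>upper_half_plane.
           Phi k lam mu nu a b c z =
             (of_nat w + 1) * (a ^ w * eisenstein (w + 2) lam z
               + b ^ w * eisenstein (w + 2) mu z + c ^ w * eisenstein (w + 2) nu z)))
        \<and> (w = 0 \<longrightarrow> (\<forall>z\<in>upper_half_plane.
           Phi k lam mu nu a b c z =
             eisenstein 2 lam z + eisenstein 2 mu z + eisenstein 2 nu z
               - 3 * eisenstein 2 (0, 0) z)))"
proof -
  \<comment> \<open>Membership in \<Lambda> is expressed through the rational parameters alone, so q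
    and the coefficients below are independent of z.\<close>
  define \<delta> where "\<delta> x = (if x \<in> \<int> \<times> \<int> then 1 else 0 :: complex)" for x :: "rat \<times> rat"
  define q where "q = \<delta> lam / a + \<delta> mu / b + \<delta> nu / c"
  define degenerate where "degenerate \<longleftrightarrow> lam \<in> \<int> \<times> \<int> \<and> a = 0 \<or> mu \<in> \<int> \<times> \<int> \<and> b = 0 \<or> nu \<in> \<int> \<times> \<int> \<and> c = 0"
  \<comment> \<open>Read off from \<open>hecke_triple_convolution\<close>, where the triple of
    weight k contributes x^(k-1) and the other sum x^(k-2).\<close>
  define co where "co x = (if degenerate then 0 else 2 * q * x ^ (k - 1) + of_nat (k - 1) * x ^ (k - 2))" for x
  define co0 where "co0 = (if degenerate \<or> k \<noteq> 2 then 0 else - 3 :: complex)"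
  let ?P = "Phi k lam mu nu a b c"
  have formula: "?P z = co a * eisenstein k lam z + co b * eisenstein k mu z + co c * eisenstein k nu z
      + co0 * eisenstein k (0, 0) z" if z: "z \<in> upper_half_plane" for z
  proof -
    interpret upper_half_point z by unfold_locales (use z in \<open>simp add: upper_half_plane_def\<close>)
    define u v w where "u = lattice_point lam z" and "v = lattice_point mu z" and "w = lattice_point nu z"
    have e: "eisenstein l x z = hecke_value l (lattice_point x z)" if "l \<ge> 1" for l x
      using eisenstein_eq_hecke_value[OF that, of x] by (simp add: lattice_point_def)
    have L: "u \<in> Lam \<longleftrightarrow> lam \<in> \<int> \<times> \<int>" "v \<in> Lam \<longleftrightarrow> mu \<in> \<int> \<times> \<int>" "w \<in> Lam \<longleftrightarrow> nu \<in> \<int> \<times> \<int>"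
      by (simp_all only: u_def v_def w_def lattice_point_in_Lam_iff)
    have q: "q = in_Lam u / a + in_Lam v / b + in_Lam w / c"
      by (simp only: q_def \<delta>_def in_Lam_def L)
    have uvw: "u + v + w \<in> Lam"
      using assms(7) by (simp add: u_def v_def w_def lattice_point_in_Lam_iff flip: lattice_point_add)
    have P: "?P z = (\<Sum>(l, m) \<in> {(l, m). l + m = k \<and> 1 \<le> l \<and> 1 \<le> m}. hecke_triple a b c u v w l * hecke_triple a b c u v w m)"
      unfolding Phi_def by (intro sum.cong) (auto simp: eisenstein_triple_def hecke_triple_def e u_def v_def w_def)
    have e0: "eisenstein 2 (0, 0) z = hecke_value 2 0" by (simp add: e lattice_point_def)
    show ?thesis
    proof (cases degenerate)
      case True
      have "hecke_triple a b c u v w l = 0" if "l \<ge> 1" for l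
        by (rule hecke_triple_degenerate'[OF uvw assms(8) that]) (use True L in \<open>auto simp: degenerate_def\<close>)
      then have "?P z = 0" unfolding P by (intro sum.neutral) auto
      then show ?thesis using True by (simp add: co_def co0_def)
    next
      case False
      have "?P z = 2 * q * hecke_triple a b c u v w k
        + of_nat (k - 1) * (a ^ (k - 2) * hecke_value k u + b ^ (k - 2) * hecke_value k v + c ^ (k - 2) * hecke_value k w)
        - (if k = 2 then 3 * hecke_value 2 0 else 0)"
        unfolding P q by (rule hecke_triple_convolution[OF uvw assms(8)]) (use False L assms(2) in \<open>auto simp: degenerate_def\<close>)
      moreover have "hecke_value k u = eisenstein k lam z" "hecke_value k v = eisenstein k mu z" "hecke_value k w = eisenstein k nu z"
        using assms(2) by (simp_all add: e u_def v_def w_def)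
      ultimately show ?thesis
        using False by (cases "k = 2") (simp_all add: co_def co0_def hecke_triple_def e0 algebra_simps)
    qed
  qed
  have hol: "?P holomorphic_on upper_half_plane"
  proof (cases "k = 2")
    case False
    then have k: "k \<ge> 3" using assms(2) by simp
    have "(\<lambda>z. co a * eisenstein k lam z + co b * eisenstein k mu z + co c * eisenstein k nu z
      + co0 * eisenstein k (0, 0) z) holomorphic_on upper_half_plane"
      by (intro holomorphic_intros eisenstein_holomorphic k)
    then show ?thesis by (subst holomorphic_cong[OF refl formula]) auto
  next
    case True
    \<comment> \<open>For k = 2 each of the three coefficients is 2 q x + 1 unless degenerate, so
      the constants give 3 - 3 and the rest is a multiple of a + b + c. The \<open>E_2\<close>
      therefore enter only through differences with \<open>E_2(0)\<close>.\<close>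
    have "co a + co b + co c + co0 = (if degenerate then 0 else 2 * q * (a + b + c))"
      using True by (simp add: co_def co0_def algebra_simps)
    then have "co a + co b + co c + co0 = 0" using assms(8) by simp
    then have c0: "co0 = - (co a + co b + co c)" by (metis add.commute add_eq_0_iff)
    have "(\<lambda>z. co a * (eisenstein 2 lam z - eisenstein 2 (0, 0) z) + co b * (eisenstein 2 mu z - eisenstein 2 (0, 0) z)
       + co c * (eisenstein 2 nu z - eisenstein 2 (0, 0) z)) holomorphic_on upper_half_plane"
      by (intro holomorphic_on_add holomorphic_on_mult holomorphic_on_const eisenstein_2_diff_holomorphic)
    moreover have "?P z = co a * (eisenstein 2 lam z - eisenstein 2 (0, 0) z) + co b * (eisenstein 2 mu z - eisenstein 2 (0, 0) z)
       + co c * (eisenstein 2 nu z - eisenstein 2 (0, 0) z)" if "z \<in> upper_half_plane" for z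
      unfolding formula[OF that] c0 using True by (simp add: algebra_simps)
    ultimately show ?thesis by (subst holomorphic_cong[OF refl]) auto
  qed
  have space: "?P \<in> eisenstein_space k N"
  proof (rule eisenstein_spaceI[OF hol, of "{..<4}" "\<lambda>i. [lam, mu, nu, (0, 0)] ! i" _ "\<lambda>i. [co a, co b, co c, co0] ! i"])
    have "(0, 0) \<in> level_lattice N"
      unfolding level_lattice_def by (intro CollectI exI[of _ 0]) simp
    then show "[lam, mu, nu, (0, 0)] ! i \<in> level_lattice N" if "i \<in> {..<4}" for i
      using that assms(4-6) by (auto simp: eval_nat_numeral less_Suc_eq)
    show "?P z = (\<Sum>i<4. [co a, co b, co c, co0] ! i * eisenstein k ([lam, mu, nu, (0, 0)] ! i) z)"
      if "z \<in> upper_half_plane" for z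
      unfolding formula[OF that] by (simp add: eval_nat_numeral)
  qed simp
  \<comment> \<open>Away from \<Lambda> there are no poles at t = 0, which leaves only the terms
    with x^(k-2).\<close>
  have "\<not> degenerate" "q = 0" if "lam \<notin> \<int> \<times> \<int>" "mu \<notin> \<int> \<times> \<int>" "nu \<notin> \<int> \<times> \<int>"
    using that by (auto simp: degenerate_def q_def \<delta>_def)
  then have co: "co x = of_nat (k - 1) * x ^ (k - 2)" "co0 = (if k = 2 then -3 else 0)"
    if "lam \<notin> \<int> \<times> \<int>" "mu \<notin> \<int> \<times> \<int>" "nu \<notin> \<int> \<times> \<int>" for x
    using that by (simp_all add: co_def co0_def)
  have k: "k = w + 2" using assms(2,3) by simp
  show ?thesis
    using hol space co formula by (auto simp: k algebra_simps numeral_2_eq_2)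
qed

end
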